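(* Let $S$ be a spacelike codimension-two embedded submanifold of a spacetime $(M,g)$ of dimension $n+2\ge4$ with a lightlike normal vector field $\xi$, let $\Sigma=\Phi(\mathscr O)$ be the lightlike hypersurface emanating from $S$ by the normal exponential construction along $\xi$ (see context), with geodesic extension $U$ of $\xi$, and assume that $\Sigma$ is totally umbilical. Then the conformal factor $\Omega$ is invariant under non-vanishing smooth rescalings of the lightlike generator. More precisely, if $\overline U=fU$ with $f$ a non-vanishing smooth function on $\Sigma$, and $\overline\Phi(p,s)=\Phi(p,h_p(s))$ is the integral curve of $\overline U$ starting at $p\in S$, then $$\overline\Omega\bigl(\overline\Phi(p,s)\bigr)=\Omega\bigl(\Phi(p,h_p(s))\bigr)$$ whenever both sides are defined.
   Context: A spacetime is a connected time-oriented Lorentzian manifold of signature $(-,+,\dots,+)$, with Levi-Civita connection $\widetilde\nabla$; lightlike vectors are nonzero null vectors; $S$ is connected of dimension $n$ with induced Riemannian metric. Normal exponential construction: choose an open neighborhood $\mathscr V$ of the zero section of the normal bundle $T^\perp S$, fiberwise star-shaped about $0$, such that the normal exponential map $\exp^\perp$ restricts to a diffeomorphism from $\mathscr V$ onto an open neighborhood of $S$ in $M$. Put $\mathscr O=\{(p,t)\in S\times\mathbb R: t\xi_p\in\mathscr V\}$, $\Phi\colon\mathscr O\to M$, $\Phi(p,t)=\exp^\perp_p(t\xi_p)$, and $\Sigma=\Phi(\mathscr O)$. Then $\Phi$ is an embedding, $\Sigma$ is a lightlike hypersurface (the induced metric is everywhere degenerate) containing $S=\Phi(S\times\{0\})$,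 and $U=\Phi_*(\partial_t)$ is a lightlike vector field on $\Sigma$ with $\widetilde\nabla_UU=0$, $U|_S=\xi$. For a lightlike vector field $W$ on $\Sigma$ put $B_W(X,Y)=-g(\widetilde\nabla_XW,Y)$; $\Sigma$ is totally umbilical if $B_U=\mu g$ for a smooth function $\mu$ on $\Sigma$, and then $B_{\overline U}=\overline\mu g$ for a smooth function $\overline\mu$. The integral curve of $\overline U$ through $p\in S$ at parameter $0$ is a reparametrization of $t\mapsto\Phi(p,t)$ and is written $s\mapsto\overline\Phi(p,s)=\Phi(p,h_p(s))$, with $h_p$ smooth, strictly monotonic and $h_p(0)=0$. The conformal factors are $$\Omega(\Phi(p,t))=\exp\left(-2\int_0^t\mu(\Phi(p,r))\,dr\right),\qquad \overline\Omega(\overline\Phi(p,s))=\exp\left(-2\int_0^s\overline\mu(\overline\Phi(p,r))\,dr\right).$$ *)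

theory Defs
  imports "HOL-Analysis.Analysis"
begin

section \<open>Smooth maps and smooth manifolds\<close>

text \<open>Meaningful for open \<open>X\<close> in a finite-dimensional space, where the existence and continuity of
  all iterated directional derivatives up to order \<open>k\<close> is the same as being of class \<open>C^k\<close>.\<close>

primrec Ck_on :: "nat \<Rightarrow> 'a::real_normed_vector set \<Rightarrow> ('a \<Rightarrow> 'b::real_normed_vector) \<Rightarrow> bool" where
  "Ck_on 0 X f = continuous_on X f"
| "Ck_on (Suc k) X f =
    ((\<forall>x\<in>X. f differentiable (at x)) \<and> (\<forall>v. Ck_on k X (\<lambda>x. frechet_derivative f (at x) v)))"

definition smooth_on :: "'a::real_normed_vector set \<Rightarrow> ('a \<Rightarrow> 'b::real_normed_vector) \<Rightarrow> bool" where
  "smooth_on X f \<longleftrightarrow> (\<forall>k. Ck_on k X f)"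

text \<open>A chart is its domain together with a coordinate map, whose values outside the domain are
  irrelevant.\<close>

type_synonym ('m, 'e) chart = "'m set \<times> ('m \<Rightarrow> 'e)"

abbreviation cdom :: "('m, 'e) chart \<Rightarrow> 'm set" where "cdom \<equiv> fst"
abbreviation coord :: "('m, 'e) chart \<Rightarrow> 'm \<Rightarrow> 'e" where "coord \<equiv> snd"

definition cinv :: "('m, 'e) chart \<Rightarrow> 'e \<Rightarrow> 'm" where
  "cinv c = inv_into (cdom c) (coord c)"

definition trans_map :: "('m, 'e) chart \<Rightarrow> ('m, 'e) chart \<Rightarrow> 'e \<Rightarrow> 'e" where
  "trans_map c d = coord d \<circ> cinv c"

definition is_chart :: "('m::topological_space, 'e::euclidean_space) chart \<Rightarrow> bool" where
  "is_chart c \<longleftrightarrow> open (cdom c) \<and> open (coord c ` cdom c) \<and>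
     homeomorphism (cdom c) (coord c ` cdom c) (coord c) (cinv c)"

definition compatible :: "('m, 'e::euclidean_space) chart \<Rightarrow> ('m, 'e) chart \<Rightarrow> bool" where
  "compatible c d \<longleftrightarrow>
     smooth_on (coord c ` (cdom c \<inter> cdom d)) (trans_map c d) \<and>
     smooth_on (coord d ` (cdom c \<inter> cdom d)) (trans_map d c)"

text \<open>A smooth structure is a maximal smooth atlas; the manifold is the whole type \<open>'m\<close>, modelled on
  the Euclidean space \<open>'e\<close>.\<close>

definition smooth_structure :: "('m::topological_space, 'e::euclidean_space) chart set \<Rightarrow> bool" where
  "smooth_structure A \<longleftrightarrow>
     (\<forall>c\<in>A. is_chart c) \<and> (\<Union>c\<in>A. cdom c) = UNIV \<and> (\<forall>c\<in>A. \<forall>d\<in>A. compatible c d) \<and>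
     (\<forall>c. is_chart c \<and> (\<forall>d\<in>A. compatible c d) \<longrightarrow> c \<in> A)"

text \<open>Smoothness of a map defined on an arbitrary subset \<open>D\<close>: near every point of \<open>D\<close> it
  is, in charts, the restriction of a smooth map on an open set. On open subsets and on embedded
  submanifolds this is the usual notion. No topology on the types is referred to, so the definition
  also applies to the tangent bundle below.\<close>

definition smooth_map ::
  "('x, 'a::real_normed_vector) chart set \<Rightarrow> ('y, 'b::real_normed_vector) chart set \<Rightarrow> 'x set \<Rightarrow> ('x \<Rightarrow> 'y) \<Rightarrow> bool"
where
  "smooth_map A B D F \<longleftrightarrow>
     (\<forall>x\<in>D. \<exists>c\<in>A. \<exists>d\<in>B. \<exists>W G. x \<in> cdom c \<and> open W \<and> coord c x \<in> W \<and> smooth_on W G \<and>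
        (\<forall>y \<in> D \<inter> cdom c. coord c y \<in> W \<longrightarrow> F y \<in> cdom d \<and> coord d (F y) = G (coord c y)))"

definition real_atlas :: "(real, real) chart set" where
  "real_atlas = {(UNIV, \<lambda>x. x)}"

definition embedded_submanifold :: "('m, 'e::euclidean_space) chart set \<Rightarrow> nat \<Rightarrow> 'm set \<Rightarrow> bool" where
  "embedded_submanifold A k N \<longleftrightarrow>
     (\<forall>p\<in>N. \<exists>c\<in>A. \<exists>L. p \<in> cdom c \<and> subspace L \<and> dim L = k \<and>
        coord c ` (cdom c \<inter> N) = coord c ` cdom c \<inter> L)"

section \<open>Tangent vectors\<close>

text \<open>A tangent vector at \<open>p\<close> is the family of its components in all charts around \<open>p\<close>, related
  by the Jacobians of the transition maps. Components in irrelevant charts are set to \<open>0\<close>, so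
  that equality of families is equality of tangent vectors.\<close>

type_synonym ('m, 'e) tvec = "('m, 'e) chart \<Rightarrow> 'e"

abbreviation tzero :: "('m, 'e::real_vector) tvec" where
  "tzero \<equiv> \<lambda>c. 0"

abbreviation tscale :: "real \<Rightarrow> ('m, 'e::real_vector) tvec \<Rightarrow> ('m, 'e) tvec" where
  "tscale r v \<equiv> \<lambda>c. r *\<^sub>R v c"

definition tangent_space :: "('m, 'e::euclidean_space) chart set \<Rightarrow> 'm \<Rightarrow> ('m, 'e) tvec set" where
  "tangent_space A p = {v.
     (\<forall>c. c \<notin> A \<or> p \<notin> cdom c \<longrightarrow> v c = 0) \<and>
     (\<forall>c\<in>A. \<forall>d\<in>A. p \<in> cdom c \<inter> cdom d \<longrightarrow>
        v d = frechet_derivative (trans_map c d) (at (coord c p)) (v c))}"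

text \<open>The tangent vector at \<open>p\<close> whose component in the chart \<open>c\<close> is \<open>u\<close>.\<close>

definition tvec_of :: "('m, 'e::euclidean_space) chart set \<Rightarrow> ('m, 'e) chart \<Rightarrow> 'm \<Rightarrow> 'e \<Rightarrow> ('m, 'e) tvec" where
  "tvec_of A c p u = (\<lambda>d. if d \<in> A \<and> p \<in> cdom d
     then frechet_derivative (trans_map c d) (at (coord c p)) u else 0)"

definition tangent_atlas ::
  "('m, 'e::euclidean_space) chart set \<Rightarrow> ('m \<times> ('m, 'e) tvec, 'e \<times> 'e) chart set" where
  "tangent_atlas A =
     (\<lambda>c. ({(p, v). p \<in> cdom c \<and> v \<in> tangent_space A p}, \<lambda>(p, v). (coord c p, v c))) ` A"

definition velocity :: "('m, 'e::euclidean_space) chart set \<Rightarrow> (real \<Rightarrow> 'm) \<Rightarrow> real \<Rightarrow> ('m, 'e) tvec" where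
  "velocity A \<gamma> t = (\<lambda>c. if c \<in> A \<and> \<gamma> t \<in> cdom c
     then vector_derivative (coord c \<circ> \<gamma>) (at t) else 0)"

definition curve_in ::
  "('m, 'e::euclidean_space) chart set \<Rightarrow> 'm set \<Rightarrow> 'm \<Rightarrow> ('m, 'e) tvec \<Rightarrow> (real \<Rightarrow> 'm) \<Rightarrow> bool" where
  "curve_in A N x X \<gamma> \<longleftrightarrow> (\<exists>\<epsilon>>0. smooth_map real_atlas A {-\<epsilon><..<\<epsilon>} \<gamma> \<and>
     \<gamma> ` {-\<epsilon><..<\<epsilon>} \<subseteq> N \<and> \<gamma> 0 = x \<and> velocity A \<gamma> 0 = X)"

text \<open>The tangent space of an embedded submanifold \<open>N\<close>, as a subset of the ambient one.\<close>

definition sub_tangent :: "('m, 'e::euclidean_space) chart set \<Rightarrow> 'm set \<Rightarrow> 'm \<Rightarrow> ('m, 'e) tvec set" where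
  "sub_tangent A N x = {X. \<exists>\<gamma>. curve_in A N x X \<gamma>}"

section \<open>Spacetimes and the Levi-Civita connection\<close>

type_synonym ('m, 'e) metric = "'m \<Rightarrow> ('m, 'e) tvec \<Rightarrow> ('m, 'e) tvec \<Rightarrow> real"

definition metric_in ::
  "('m, 'e::euclidean_space) chart set \<Rightarrow> ('m, 'e) metric \<Rightarrow> ('m, 'e) chart \<Rightarrow> 'm \<Rightarrow> 'e \<Rightarrow> 'e \<Rightarrow> real" where
  "metric_in A g c p u v = g p (tvec_of A c p u) (tvec_of A c p v)"

text \<open>A bilinear form of signature \<open>(-,+,...,+)\<close>.\<close>

definition lorentz_form :: "('e::euclidean_space \<Rightarrow> 'e \<Rightarrow> real) \<Rightarrow> bool" where
  "lorentz_form B \<longleftrightarrow> bilinear B \<and>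
     (\<exists>E::'e \<Rightarrow> 'e. \<exists>b0\<in>Basis. linear E \<and> bij E \<and>
        (\<forall>i\<in>Basis. \<forall>j\<in>Basis. B (E i) (E j) = (if i \<noteq> j then 0 else if i = b0 then -1 else 1)))"

definition lorentzian_metric :: "('m, 'e::euclidean_space) chart set \<Rightarrow> ('m, 'e) metric \<Rightarrow> bool" where
  "lorentzian_metric A g \<longleftrightarrow>
     (\<forall>c\<in>A. (\<forall>p\<in>cdom c. lorentz_form (metric_in A g c p)) \<and>
            (\<forall>u v. smooth_on (coord c ` cdom c) (\<lambda>x. metric_in A g c (cinv c x) u v)))"

text \<open>A time orientation is given by a smooth timelike vector field \<open>T\<close>.\<close>

definition spacetime ::
  "('m::{t2_space, second_countable_topology}, 'e::euclidean_space) chart set \<Rightarrow> ('m, 'e) metric \<Rightarrow> bool" where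
  "spacetime A g \<longleftrightarrow> smooth_structure A \<and> connected (UNIV :: 'm set) \<and> lorentzian_metric A g \<and>
     (\<exists>T. (\<forall>p. T p \<in> tangent_space A p \<and> g p (T p) (T p) < 0) \<and>
          smooth_map A (tangent_atlas A) UNIV (\<lambda>p. (p, T p)))"

text \<open>An affine connection is given by its Christoffel symbols \<open>\<Gamma> c p u v\<close> in every chart \<open>c\<close>
  (\<open>u\<close> being the direction of differentiation), subject to the transformation law for
  Christoffel symbols under a change of charts \<open>\<tau>\<close>,
  \<open>\<tau>'(\<Gamma> c (u, v)) = \<Gamma> d (\<tau>' u, \<tau>' v) + \<tau>''(u, v)\<close>.\<close>

type_synonym ('m, 'e) conn = "('m, 'e) chart \<Rightarrow> 'm \<Rightarrow> 'e \<Rightarrow> 'e \<Rightarrow> 'e"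

definition affine_connection :: "('m, 'e::euclidean_space) chart set \<Rightarrow> ('m, 'e) conn \<Rightarrow> bool" where
  "affine_connection A \<Gamma> \<longleftrightarrow>
     (\<forall>c\<in>A. (\<forall>p\<in>cdom c. bilinear (\<Gamma> c p)) \<and>
            (\<forall>u v. smooth_on (coord c ` cdom c) (\<lambda>x. \<Gamma> c (cinv c x) u v))) \<and>
     (\<forall>c\<in>A. \<forall>d\<in>A. \<forall>p \<in> cdom c \<inter> cdom d. \<forall>u v.
        let \<tau>' = (\<lambda>y. frechet_derivative (trans_map c d) (at y)); x = coord c p in
          \<tau>' x (\<Gamma> c p u v) =
            \<Gamma> d p (\<tau>' x u) (\<tau>' x v) + frechet_derivative (\<lambda>y. \<tau>' y v) (at x) u)"

definition torsion_free :: "('m, 'e::euclidean_space) chart set \<Rightarrow> ('m, 'e) conn \<Rightarrow> bool" where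
  "torsion_free A \<Gamma> \<longleftrightarrow> (\<forall>c\<in>A. \<forall>p\<in>cdom c. \<forall>u v. \<Gamma> c p u v = \<Gamma> c p v u)"

definition metric_connection ::
  "('m, 'e::euclidean_space) chart set \<Rightarrow> ('m, 'e) metric \<Rightarrow> ('m, 'e) conn \<Rightarrow> bool" where
  "metric_connection A g \<Gamma> \<longleftrightarrow>
     (\<forall>c\<in>A. \<forall>p\<in>cdom c. \<forall>u v w.
        frechet_derivative (\<lambda>x. metric_in A g c (cinv c x) u v) (at (coord c p)) w =
          metric_in A g c p (\<Gamma> c p w u) v + metric_in A g c p u (\<Gamma> c p w v))"

definition levi_civita ::
  "('m, 'e::euclidean_space) chart set \<Rightarrow> ('m, 'e) metric \<Rightarrow> ('m, 'e) conn \<Rightarrow> bool" where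
  "levi_civita A g \<Gamma> \<longleftrightarrow> affine_connection A \<Gamma> \<and> torsion_free A \<Gamma> \<and> metric_connection A g \<Gamma>"

text \<open>The covariant derivative at time \<open>t\<close> of a vector field \<open>V\<close> along the curve \<open>\<gamma>\<close>.\<close>

definition covd ::
  "('m, 'e::euclidean_space) chart set \<Rightarrow> ('m, 'e) conn \<Rightarrow> (real \<Rightarrow> 'm) \<Rightarrow> (real \<Rightarrow> ('m, 'e) tvec) \<Rightarrow> real
     \<Rightarrow> ('m, 'e) tvec" where
  "covd A \<Gamma> \<gamma> V t = (\<lambda>c. if c \<in> A \<and> \<gamma> t \<in> cdom c
     then vector_derivative (\<lambda>s. V s c) (at t) + \<Gamma> c (\<gamma> t) (velocity A \<gamma> t c) (V t c) else 0)"

text \<open>The covariant derivative at \<open>x\<close>, in a direction \<open>X\<close> tangent to \<open>N\<close>, of a vector field \<open>W\<close>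
  given only along \<open>N\<close>. For smooth \<open>W\<close> it does not depend on the chosen curve.\<close>

definition dir_covd ::
  "('m, 'e::euclidean_space) chart set \<Rightarrow> ('m, 'e) conn \<Rightarrow> 'm set \<Rightarrow> ('m \<Rightarrow> ('m, 'e) tvec) \<Rightarrow>
     'm \<Rightarrow> ('m, 'e) tvec \<Rightarrow> ('m, 'e) tvec" where
  "dir_covd A \<Gamma> N W x X = (let \<gamma> = (SOME \<gamma>. curve_in A N x X \<gamma>) in covd A \<Gamma> \<gamma> (W \<circ> \<gamma>) 0)"

definition geodesic ::
  "('m, 'e::euclidean_space) chart set \<Rightarrow> ('m, 'e) conn \<Rightarrow> real set \<Rightarrow> (real \<Rightarrow> 'm) \<Rightarrow> bool" where
  "geodesic A \<Gamma> I \<gamma> \<longleftrightarrow> smooth_map real_atlas A I \<gamma> \<and> (\<forall>t\<in>I. covd A \<Gamma> \<gamma> (velocity A \<gamma>) t = tzero)"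

definition exp_rel ::
  "('m, 'e::euclidean_space) chart set \<Rightarrow> ('m, 'e) conn \<Rightarrow> 'm \<times> ('m, 'e) tvec \<Rightarrow> 'm \<Rightarrow> bool" where
  "exp_rel A \<Gamma> pv q \<longleftrightarrow> (\<exists>\<gamma> I. open I \<and> is_interval I \<and> 0 \<in> I \<and> 1 \<in> I \<and> geodesic A \<Gamma> I \<gamma> \<and>
     \<gamma> 0 = fst pv \<and> velocity A \<gamma> 0 = snd pv \<and> \<gamma> 1 = q)"

definition exp_domain ::
  "('m, 'e::euclidean_space) chart set \<Rightarrow> ('m, 'e) conn \<Rightarrow> ('m \<times> ('m, 'e) tvec) set" where
  "exp_domain A \<Gamma> = {pv. \<exists>q. exp_rel A \<Gamma> pv q}"

definition exp_map ::
  "('m, 'e::euclidean_space) chart set \<Rightarrow> ('m, 'e) conn \<Rightarrow> 'm \<times> ('m, 'e) tvec \<Rightarrow> 'm" where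
  "exp_map A \<Gamma> pv = (THE q. exp_rel A \<Gamma> pv q)"

section \<open>Spacelike submanifolds and normal exponential neighbourhoods\<close>

definition spacelike :: "('m, 'e::euclidean_space) chart set \<Rightarrow> ('m, 'e) metric \<Rightarrow> 'm set \<Rightarrow> bool" where
  "spacelike A g S \<longleftrightarrow> (\<forall>p\<in>S. \<forall>v\<in>sub_tangent A S p. v \<noteq> tzero \<longrightarrow> g p v v > 0)"

definition normal_bundle ::
  "('m, 'e::euclidean_space) chart set \<Rightarrow> ('m, 'e) metric \<Rightarrow> 'm set \<Rightarrow> ('m \<times> ('m, 'e) tvec) set" where
  "normal_bundle A g S =
     {(p, v). p \<in> S \<and> v \<in> tangent_space A p \<and> (\<forall>w\<in>sub_tangent A S p. g p v w = 0)}"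

definition lightlike :: "('m, 'e::euclidean_space) metric \<Rightarrow> 'm \<Rightarrow> ('m, 'e) tvec \<Rightarrow> bool" where
  "lightlike g p v \<longleftrightarrow> v \<noteq> tzero \<and> g p v v = 0"

definition lightlike_normal_field ::
  "('m, 'e::euclidean_space) chart set \<Rightarrow> ('m, 'e) metric \<Rightarrow> 'm set \<Rightarrow> ('m \<Rightarrow> ('m, 'e) tvec) \<Rightarrow> bool" where
  "lightlike_normal_field A g S \<xi> \<longleftrightarrow>
     (\<forall>p\<in>S. (p, \<xi> p) \<in> normal_bundle A g S \<and> lightlike g p (\<xi> p)) \<and>
     smooth_map A (tangent_atlas A) S (\<lambda>p. (p, \<xi> p))"

definition rel_open_in_TM ::
  "('m, 'e::euclidean_space) chart set \<Rightarrow> ('m \<times> ('m, 'e) tvec) set \<Rightarrow> ('m \<times> ('m, 'e) tvec) set \<Rightarrow> bool" where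
  "rel_open_in_TM A E V \<longleftrightarrow> V \<subseteq> E \<and>
     (\<forall>x\<in>V. \<exists>c\<in>tangent_atlas A. \<exists>W. x \<in> cdom c \<and> open W \<and> coord c x \<in> W \<and>
        (\<forall>y \<in> E \<inter> cdom c. coord c y \<in> W \<longrightarrow> y \<in> V))"

definition normal_exp_nbhd ::
  "('m::topological_space, 'e::euclidean_space) chart set \<Rightarrow> ('m, 'e) metric \<Rightarrow> ('m, 'e) conn \<Rightarrow> 'm set \<Rightarrow>
     ('m \<times> ('m, 'e) tvec) set \<Rightarrow> bool" where
  "normal_exp_nbhd A g \<Gamma> S V \<longleftrightarrow>
     rel_open_in_TM A (normal_bundle A g S) V \<and>
     (\<forall>p\<in>S. (p, tzero) \<in> V) \<and>
     (\<forall>p v r. (p, v) \<in> V \<and> 0 \<le> r \<and> r \<le> 1 \<longrightarrow> (p, tscale r v) \<in> V) \<and>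
     V \<subseteq> exp_domain A \<Gamma> \<and>
     (\<exists>N. open N \<and> S \<subseteq> N \<and> bij_betw (exp_map A \<Gamma>) V N \<and>
          smooth_map (tangent_atlas A) A V (exp_map A \<Gamma>) \<and>
          smooth_map A (tangent_atlas A) N (inv_into V (exp_map A \<Gamma>)))"

section \<open>The lightlike hypersurface and its conformal factors\<close>

definition null_domain ::
  "'m set \<Rightarrow> ('m \<Rightarrow> ('m, 'e::euclidean_space) tvec) \<Rightarrow> ('m \<times> ('m, 'e) tvec) set \<Rightarrow> ('m \<times> real) set" where
  "null_domain S \<xi> V = {(p, t). p \<in> S \<and> (p, tscale t (\<xi> p)) \<in> V}"

definition null_param ::
  "('m, 'e::euclidean_space) chart set \<Rightarrow> ('m, 'e) conn \<Rightarrow> ('m \<Rightarrow> ('m, 'e) tvec) \<Rightarrow> 'm \<times> real \<Rightarrow> 'm" where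
  "null_param A \<Gamma> \<xi> = (\<lambda>(p, t). exp_map A \<Gamma> (p, tscale t (\<xi> p)))"

text \<open>The push-forward along \<open>\<Phi>\<close>, injective on \<open>D\<close>, of the coordinate field of the real factor.\<close>

definition push_dt ::
  "('m, 'e::euclidean_space) chart set \<Rightarrow> ('m \<times> real) set \<Rightarrow> ('m \<times> real \<Rightarrow> 'm) \<Rightarrow> 'm \<Rightarrow> ('m, 'e) tvec" where
  "push_dt A D \<Phi> x = (let (p, t) = inv_into D \<Phi> x in velocity A (\<lambda>r. \<Phi> (p, r)) t)"

definition smooth_fun :: "('m, 'e::euclidean_space) chart set \<Rightarrow> 'm set \<Rightarrow> ('m \<Rightarrow> real) \<Rightarrow> bool" where
  "smooth_fun A N f \<longleftrightarrow> smooth_map A real_atlas N f"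

definition null_second_form ::
  "('m, 'e::euclidean_space) chart set \<Rightarrow> ('m, 'e) metric \<Rightarrow> ('m, 'e) conn \<Rightarrow> 'm set \<Rightarrow>
     ('m \<Rightarrow> ('m, 'e) tvec) \<Rightarrow> 'm \<Rightarrow> ('m, 'e) tvec \<Rightarrow> ('m, 'e) tvec \<Rightarrow> real" where
  "null_second_form A g \<Gamma> N W x X Y = - g x (dir_covd A \<Gamma> N W x X) Y"

definition umbilical_factor ::
  "('m, 'e::euclidean_space) chart set \<Rightarrow> ('m, 'e) metric \<Rightarrow> ('m, 'e) conn \<Rightarrow> 'm set \<Rightarrow>
     ('m \<Rightarrow> ('m, 'e) tvec) \<Rightarrow> ('m \<Rightarrow> real) \<Rightarrow> bool" where
  "umbilical_factor A g \<Gamma> N W \<mu> \<longleftrightarrow> smooth_fun A N \<mu> \<and>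
     (\<forall>x\<in>N. \<forall>X\<in>sub_tangent A N x. \<forall>Y\<in>sub_tangent A N x.
        null_second_form A g \<Gamma> N W x X Y = \<mu> x * g x X Y)"

definition integral_curve ::
  "('m, 'e::euclidean_space) chart set \<Rightarrow> ('m \<Rightarrow> ('m, 'e) tvec) \<Rightarrow> real set \<Rightarrow> (real \<Rightarrow> 'm) \<Rightarrow> bool" where
  "integral_curve A W I \<gamma> \<longleftrightarrow>
     smooth_map real_atlas A I \<gamma> \<and> (\<forall>s\<in>I. velocity A \<gamma> s = W (\<gamma> s))"

text \<open>A function of the points of \<open>\<Phi> ` D\<close>, where \<open>\<Phi>\<close> is injective on \<open>D\<close>. The integral is the
  oriented one, so negative \<open>t\<close> is allowed.\<close>

definition conformal_factor ::
  "('m \<times> real) set \<Rightarrow> ('m \<times> real \<Rightarrow> 'm) \<Rightarrow> ('m \<Rightarrow> real) \<Rightarrow> 'm \<Rightarrow> real" where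
  "conformal_factor D \<Phi> \<mu> x =
     (let (p, t) = inv_into D \<Phi> x in exp (- 2 * (LBINT r=ereal 0..ereal t. \<mu> (\<Phi> (p, r)))))"

end

theory Submission
  imports Defs
begin

text \<open>
  For tangent vectors \<open>X, Y\<close> of \<open>\<Sigma>\<close> the Leibniz rule gives
  \<open>B\<^bsub>fU\<^esub>(X, Y) = f B\<^sub>U(X, Y) - X(f) g(U, Y)\<close>, so the two umbilicity conditions say
  \<open>(\<mu>' - f \<mu>) g(X, Y) = - X(f) g(U, Y)\<close>. If \<open>\<mu>' \<noteq> f \<mu>\<close> at a point, the kernel of \<open>df\<close> in the
  tangent space of \<open>\<Sigma>\<close>, which has dimension at least \<open>n \<ge> 2\<close>, would be totally isotropic;
  a Lorentzian form has no isotropic plane, so \<open>\<mu>' = f \<mu>\<close> and no Gauss lemma is needed. Since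
  \<open>U\<close> does not vanish, the integral curve equation says \<open>h\<^sub>p' = f\<close> along the curve, and the claim is
  the substitution rule for the integral of \<open>\<mu>\<close> along the null geodesic.
\<close>

section \<open>Calculus of smooth maps\<close>

text \<open>The derivative inside \<open>null_second_form\<close> is taken along a curve picked by
  \<open>SOME\<close>. That choice depends on the set, the point and the vector, but not on the
  field, so \<open>U\<close> and its rescaling are differentiated along one common curve and the
  Leibniz rule compares them there. A tangent vector is a coherent family of components, and
  \<open>g\<close> is controlled on such families only. A covariant derivative must therefore be
  shown to be coherent before \<open>g\<close> is split over a sum; this is where the transformation
  law of the Christoffel symbols enters. \<open>sub_tangent\<close> is a bare set of velocities, so
  the isotropy argument needs explicit curves filling a space of components of dimension
  \<open>n + 1\<close>. Intersecting it with the kernel of a linear form on a model space of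
  dimension \<open>N\<close> leaves at least \<open>(n + 1) + (N - 1) - N = n\<close> dimensions.
  Regularity of the hypersurface comes from the smooth inverse of the exponential map: it makes
  \<open>U\<close> smooth, and it shows that \<open>U\<close> has no zeros, because a smooth map
  sends zero velocity to zero velocity.\<close>

lemma Ck_on_SucD:
  assumes "Ck_on (Suc k) X f"
  shows "x \<in> X \<Longrightarrow> (f has_derivative frechet_derivative f (at x)) (at x)"
    and "Ck_on k X (\<lambda>x. frechet_derivative f (at x) v)"
  using assms by (auto simp: frechet_derivative_works)

lemma Ck_on_Suc_imp: "Ck_on (Suc k) X f \<Longrightarrow> Ck_on k X f"
proof (induction k arbitrary: f)
  case 0
  then show ?case
    by (auto intro!: continuous_at_imp_continuous_on differentiable_imp_continuous_within)
next
  case (Suc k)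
  then show ?case by (metis Ck_on.simps(2))
qed

text \<open>Openness turns equality on \<open>X\<close> into equality near each of its points, so
  all derivatives agree there as well.\<close>

lemma Ck_on_cong:
  assumes "open X" "Ck_on k X f" "\<And>x. x \<in> X \<Longrightarrow> f x = g x"
  shows "Ck_on k X g"
  using assms(2,3)
proof (induction k arbitrary: f g)
  case 0
  then show ?case by (simp cong: continuous_on_cong)
next
  case (Suc k)
  have g: "(g has_derivative frechet_derivative f (at x)) (at x)" if "x \<in> X" for x
    using Ck_on_SucD(1)[OF Suc.prems(1) that] assms(1) that Suc.prems(2)
    by (rule has_derivative_transform_within_open)
  then have eq: "frechet_derivative f (at x) = frechet_derivative g (at x)" if "x \<in> X" for x
    using frechet_derivative_at that by metis
  have "Ck_on k X (\<lambda>x. frechet_derivative g (at x) v)" for v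
    by (rule Suc.IH[OF Ck_on_SucD(2)[OF Suc.prems(1), of v]]) (simp add: eq)
  then show ?case using g by (auto simp: differentiable_def)
qed

text \<open>Uniqueness of derivatives identifies a formula found by the calculus rules with
  \<open>frechet_derivative\<close>. The sum, product and chain rules below run their inductions on
  the order through this.\<close>

lemma Ck_on_SucI:
  assumes "open X" "\<And>x. x \<in> X \<Longrightarrow> (f has_derivative f' x) (at x)"
    and "\<And>v. Ck_on k X (\<lambda>x. f' x v)"
  shows "Ck_on (Suc k) X f"
proof -
  have "Ck_on k X (\<lambda>x. frechet_derivative f (at x) v)" for v
    by (rule Ck_on_cong[OF assms(1) assms(3)[of v]]) (metis assms(2) frechet_derivative_at)
  then show ?thesis using assms(2) by (auto simp: differentiable_def)
qed

lemma Ck_on_subset: "Ck_on k X f \<Longrightarrow> Y \<subseteq> X \<Longrightarrow> Ck_on k Y f"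
  by (induction k arbitrary: f) (auto intro: continuous_on_subset)

lemma Ck_on_const: "Ck_on k X (\<lambda>x. a)"
  by (induction k arbitrary: a) (auto intro: continuous_intros)

lemma Ck_on_bounded_linear:
  assumes "open X" "bounded_linear L" "Ck_on k X f"
  shows "Ck_on k X (\<lambda>x. L (f x))"
  using assms(3)
proof (induction k arbitrary: f)
  case 0
  then show ?case using assms(2) by (auto intro: bounded_linear.continuous_on)
next
  case (Suc k)
  show ?case
    using assms(1) bounded_linear.has_derivative[OF assms(2) Ck_on_SucD(1)[OF Suc.prems]]
      Suc.IH[OF Ck_on_SucD(2)[OF Suc.prems]]
    by (rule Ck_on_SucI)
qed

lemma Ck_on_add:
  assumes "open X" "Ck_on k X f" "Ck_on k X g"
  shows "Ck_on k X (\<lambda>x. f x + g x)"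
  using assms(2,3)
proof (induction k arbitrary: f g)
  case 0
  then show ?case by (auto intro: continuous_intros)
next
  case (Suc k)
  show ?case
    using assms(1) has_derivative_add[OF Ck_on_SucD(1)[OF Suc.prems(1)] Ck_on_SucD(1)[OF Suc.prems(2)]]
      Suc.IH[OF Ck_on_SucD(2)[OF Suc.prems(1)] Ck_on_SucD(2)[OF Suc.prems(2)]]
    by (rule Ck_on_SucI)
qed

text \<open>Each of the two terms of the product rule differentiates one factor only; the other
  factor is lowered by one order to fit the induction hypothesis.\<close>

lemma Ck_on_bounded_bilinear:
  assumes "open X" "bounded_bilinear P" "Ck_on k X f" "Ck_on k X g"
  shows "Ck_on k X (\<lambda>x. P (f x) (g x))"
  using assms(3,4)
proof (induction k arbitrary: f g)
  case 0
  then show ?case using assms(2) by (auto intro: bounded_bilinear.continuous_on)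
next
  case (Suc k)
  show ?case
    using assms(1)
      bounded_bilinear.FDERIV[OF assms(2) Ck_on_SucD(1)[OF Suc.prems(1)] Ck_on_SucD(1)[OF Suc.prems(2)]]
      Ck_on_add[OF assms(1)
        Suc.IH[OF Ck_on_Suc_imp[OF Suc.prems(1)] Ck_on_SucD(2)[OF Suc.prems(2)]]
        Suc.IH[OF Ck_on_SucD(2)[OF Suc.prems(1)] Ck_on_Suc_imp[OF Suc.prems(2)]]]
    by (rule Ck_on_SucI)
qed

lemma Ck_on_sum:
  assumes "open X" "\<And>i. i \<in> I \<Longrightarrow> Ck_on k X (f i)"
  shows "Ck_on k X (\<lambda>x. \<Sum>i\<in>I. f i x)"
  using assms(2)
  by (induction I rule: infinite_finite_induct) (auto intro: Ck_on_const Ck_on_add[OF assms(1)])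

lemma linear_eq_sum_Basis:
  fixes F :: "'a::euclidean_space \<Rightarrow> 'b::real_vector"
  assumes "linear F"
  shows "F v = (\<Sum>b\<in>Basis. (v \<bullet> b) *\<^sub>R F b)"
  using assms by (metis (no_types, lifting) euclidean_representation linear_scale linear_sum sum.cong)

text \<open>In the chain rule both the base point and the direction fed to the derivative of
  \<open>g\<close> depend on \<open>x\<close>. Expanding the direction in the basis leaves
  derivatives of \<open>g\<close> in fixed directions, which the induction hypothesis
  covers.\<close>

lemma Ck_on_compose:
  fixes f :: "'a::real_normed_vector \<Rightarrow> 'b::euclidean_space" and g :: "'b \<Rightarrow> 'c::real_normed_vector"
  assumes "open X" "Ck_on k Y g" "Ck_on k X f" "f ` X \<subseteq> Y"
  shows "Ck_on k X (\<lambda>x. g (f x))"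
  using assms(2,3)
proof (induction k arbitrary: g)
  case 0
  then show ?case using assms(4) by (auto intro: continuous_on_compose2)
next
  case (Suc k)
  note g = Ck_on_SucD[OF Suc.prems(1)] and f = Ck_on_SucD[OF Suc.prems(2)]
  let ?D = "\<lambda>x v. \<Sum>b\<in>Basis. (frechet_derivative f (at x) v \<bullet> b) *\<^sub>R frechet_derivative g (at (f x)) b"
  have "((\<lambda>x. g (f x)) has_derivative ?D x) (at x)" if x: "x \<in> X" for x
  proof -
    have fx: "f x \<in> Y" using x assms(4) by auto
    have "frechet_derivative g (at (f x)) (frechet_derivative f (at x) v) = ?D x v" for v
      by (rule linear_eq_sum_Basis) (use g(1)[OF fx] has_derivative_linear in blast)
    moreover have "((\<lambda>x. g (f x)) has_derivative
        (\<lambda>v. frechet_derivative g (at (f x)) (frechet_derivative f (at x) v))) (at x)"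
      using has_derivative_compose[OF f(1)[OF x] g(1)[OF fx]] .
    ultimately show ?thesis by simp
  qed
  moreover have "Ck_on k X (\<lambda>x. ?D x v)" for v
    using f(2)[of v] Suc.IH[OF g(2) Ck_on_Suc_imp[OF Suc.prems(2)]]
    by (auto intro!: Ck_on_sum assms(1) Ck_on_bounded_bilinear[OF _ bounded_bilinear_scaleR]
      Ck_on_bounded_linear[OF _ bounded_linear_inner_left])
  ultimately show ?case using assms(1) by (intro Ck_on_SucI)
qed

lemma smooth_onD:
  assumes "smooth_on X f"
  shows "x \<in> X \<Longrightarrow> (f has_derivative frechet_derivative f (at x)) (at x)"
    and "smooth_on X (\<lambda>x. frechet_derivative f (at x) v)"
    and "continuous_on X f"
  using assms Ck_on_SucD unfolding smooth_on_def by (blast, blast, metis Ck_on.simps(1))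

lemma smooth_on_linear: "smooth_on X f \<Longrightarrow> x \<in> X \<Longrightarrow> linear (frechet_derivative f (at x))"
  using smooth_onD(1) has_derivative_linear by blast

lemma smooth_on_cong: "open X \<Longrightarrow> smooth_on X f \<Longrightarrow> (\<And>x. x \<in> X \<Longrightarrow> f x = g x) \<Longrightarrow> smooth_on X g"
  unfolding smooth_on_def using Ck_on_cong by blast

lemma smooth_on_subset: "smooth_on X f \<Longrightarrow> Y \<subseteq> X \<Longrightarrow> smooth_on Y f"
  unfolding smooth_on_def using Ck_on_subset by blast

lemma smooth_on_const: "smooth_on X (\<lambda>x. a)"
  unfolding smooth_on_def by (simp add: Ck_on_const)

lemma smooth_on_bounded_linear:
  "open X \<Longrightarrow> bounded_linear L \<Longrightarrow> smooth_on X f \<Longrightarrow> smooth_on X (\<lambda>x. L (f x))"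
  unfolding smooth_on_def using Ck_on_bounded_linear by blast

lemma smooth_on_id:
  assumes "open X"
  shows "smooth_on X (\<lambda>x. x)"
proof -
  have "Ck_on k X (\<lambda>x. x)" for k
    using assms by (cases k) (auto intro!: Ck_on_SucI[where f' = "\<lambda>x v. v"] Ck_on_const
      continuous_intros derivative_eq_intros simp del: Ck_on.simps(2))
  then show ?thesis by (simp add: smooth_on_def)
qed

lemma smooth_on_add:
  "open X \<Longrightarrow> smooth_on X f \<Longrightarrow> smooth_on X g \<Longrightarrow> smooth_on X (\<lambda>x. f x + g x)"
  unfolding smooth_on_def using Ck_on_add by blast

lemma smooth_on_scaleR:
  "open X \<Longrightarrow> smooth_on X f \<Longrightarrow> smooth_on X g \<Longrightarrow> smooth_on X (\<lambda>x. f x *\<^sub>R g x)"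
  unfolding smooth_on_def using Ck_on_bounded_bilinear[OF _ bounded_bilinear_scaleR] by blast

lemma smooth_on_sum:
  "open X \<Longrightarrow> (\<And>i. i \<in> I \<Longrightarrow> smooth_on X (f i)) \<Longrightarrow> smooth_on X (\<lambda>x. \<Sum>i\<in>I. f i x)"
  by (auto simp: smooth_on_def intro: Ck_on_sum)

lemma smooth_on_compose:
  fixes f :: "'a::real_normed_vector \<Rightarrow> 'b::euclidean_space" and g :: "'b \<Rightarrow> 'c::real_normed_vector"
  shows "open X \<Longrightarrow> smooth_on Y g \<Longrightarrow> smooth_on X f \<Longrightarrow> f ` X \<subseteq> Y \<Longrightarrow> smooth_on X (\<lambda>x. g (f x))"
  by (auto simp: smooth_on_def intro: Ck_on_compose)

lemma smooth_on_fst: "open X \<Longrightarrow> smooth_on X f \<Longrightarrow> smooth_on X (\<lambda>x. fst (f x))"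
  by (rule smooth_on_bounded_linear[OF _ bounded_linear_fst])

lemma smooth_on_snd: "open X \<Longrightarrow> smooth_on X f \<Longrightarrow> smooth_on X (\<lambda>x. snd (f x))"
  by (rule smooth_on_bounded_linear[OF _ bounded_linear_snd])

lemma smooth_on_Pair:
  fixes f :: "'a::real_normed_vector \<Rightarrow> 'b::real_normed_vector"
    and g :: "'a \<Rightarrow> 'c::real_normed_vector"
  assumes "open X" "smooth_on X f" "smooth_on X g"
  shows "smooth_on X (\<lambda>x. (f x, g x))"
proof -
  have "bounded_linear (\<lambda>a::'b. (a, 0::'c))" "bounded_linear (\<lambda>b::'c. (0::'b, b))"
    by (auto intro: bounded_linear_Pair bounded_linear_ident bounded_linear_zero)
  then have "smooth_on X (\<lambda>x. (f x, 0) + (0, g x))"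
    using assms by (intro smooth_on_add smooth_on_bounded_linear[where L = "\<lambda>a::'b. (a, 0::'c)"]
      smooth_on_bounded_linear[where L = "\<lambda>b::'c. (0::'b, b)"]) auto
  then show ?thesis by simp
qed

text \<open>Linearity in the direction reduces the claim to finitely many fixed directions. Its main
  use is with transition maps, where it gives smoothness of the charts of the tangent
  bundle.\<close>

lemma smooth_on_derivative_apply:
  fixes f :: "'a::euclidean_space \<Rightarrow> 'b::real_normed_vector"
    and a v :: "'c::real_normed_vector \<Rightarrow> 'a"
  assumes "open X" "smooth_on Y f" "smooth_on X a" "smooth_on X v" "a ` X \<subseteq> Y"
  shows "smooth_on X (\<lambda>z. frechet_derivative f (at (a z)) (v z))"
proof -
  have "smooth_on X (\<lambda>z. \<Sum>b\<in>Basis. (v z \<bullet> b) *\<^sub>R frechet_derivative f (at (a z)) b)"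
    by (intro smooth_on_sum smooth_on_scaleR assms(1)
        smooth_on_bounded_linear[OF _ bounded_linear_inner_left]
        smooth_on_compose[OF _ smooth_onD(2)[OF assms(2)]] assms)
  then show ?thesis
    by (rule smooth_on_cong[OF assms(1)])
      (use linear_eq_sum_Basis[OF smooth_on_linear[OF assms(2)]] assms(5) in \<open>simp add: image_subset_iff\<close>)
qed

lemma open_vimage_smooth_on:
  "smooth_on X f \<Longrightarrow> open X \<Longrightarrow> open Y \<Longrightarrow> open {z \<in> X. f z \<in> Y}"
  using continuous_open_preimage[OF smooth_onD(3), of X f Y] by (simp add: vimage_def Int_def)

section \<open>Smooth maps between manifolds\<close>

text \<open>The part of the definition of a smooth structure that makes no reference to the topology of
  the manifold, so that it also applies to the tangent bundle.\<close>

definition smooth_atlas :: "('x, 'e::euclidean_space) chart set \<Rightarrow> bool" where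
  "smooth_atlas A \<longleftrightarrow> (\<forall>c\<in>A. inj_on (coord c) (cdom c)) \<and>
     (\<forall>c\<in>A. \<forall>d\<in>A. open (coord c ` (cdom c \<inter> cdom d)) \<and>
        smooth_on (coord c ` (cdom c \<inter> cdom d)) (trans_map c d))"

lemma smooth_atlasD:
  assumes "smooth_atlas A" "c \<in> A" "d \<in> A"
  shows "inj_on (coord c) (cdom c)" "open (coord c ` (cdom c \<inter> cdom d))"
    "smooth_on (coord c ` (cdom c \<inter> cdom d)) (trans_map c d)"
  using assms unfolding smooth_atlas_def by blast+

lemma cinv_coord:
  assumes "smooth_atlas A" "c \<in> A" "x \<in> cdom c"
  shows "cinv c (coord c x) = x"
  using assms unfolding smooth_atlas_def cinv_def by (simp add: inv_into_f_f)

lemma trans_map_coord: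
  assumes "smooth_atlas A" "c \<in> A" "x \<in> cdom c"
  shows "trans_map c d (coord c x) = coord d x"
  unfolding trans_map_def using cinv_coord[OF assms] by simp

lemma coord_in_imageD:
  assumes "smooth_atlas A" "c \<in> A" "x \<in> cdom c" "coord c x \<in> coord c ` (cdom c \<inter> Y)"
  shows "x \<in> Y"
  using assms unfolding smooth_atlas_def by (auto dest: inj_onD)

text \<open>\<open>D\<close> may have empty interior. Then \<open>G\<close> extends the coordinate
  expression of \<open>F\<close> off \<open>D\<close> and is prescribed by \<open>F\<close> only at
  coordinates of points of \<open>D\<close>.\<close>

definition local_rep ::
  "'x set \<Rightarrow> ('x \<Rightarrow> 'y) \<Rightarrow> ('x, 'a::real_normed_vector) chart \<Rightarrow> ('y, 'b::real_normed_vector) chart \<Rightarrow>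
     'a set \<Rightarrow> ('a \<Rightarrow> 'b) \<Rightarrow> bool" where
  "local_rep D F c d W G \<longleftrightarrow> open W \<and> smooth_on W G \<and>
     (\<forall>y \<in> D \<inter> cdom c. coord c y \<in> W \<longrightarrow> F y \<in> cdom d \<and> coord d (F y) = G (coord c y))"

lemma local_repD:
  assumes "local_rep D F c d W G"
  shows "open W" "smooth_on W G"
    "y \<in> D \<Longrightarrow> y \<in> cdom c \<Longrightarrow> coord c y \<in> W \<Longrightarrow> F y \<in> cdom d"
    "y \<in> D \<Longrightarrow> y \<in> cdom c \<Longrightarrow> coord c y \<in> W \<Longrightarrow> coord d (F y) = G (coord c y)"
  using assms by (simp_all add: local_rep_def)

lemma smooth_map_iff:
  "smooth_map A B D F \<longleftrightarrow>
     (\<forall>x\<in>D. \<exists>c\<in>A. \<exists>d\<in>B. x \<in> cdom c \<and> (\<exists>W G. coord c x \<in> W \<and> local_rep D F c d W G))"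
  unfolding smooth_map_def local_rep_def
  by (intro ball_cong bex_cong refl) blast

lemma smooth_mapI:
  assumes "\<And>x. x \<in> D \<Longrightarrow> \<exists>c\<in>A. \<exists>d\<in>B. x \<in> cdom c \<and> (\<exists>W G. coord c x \<in> W \<and> local_rep D F c d W G)"
  shows "smooth_map A B D F"
  unfolding smooth_map_iff by (intro ballI assms)

lemma smooth_mapE:
  assumes "smooth_map A B D F" "x \<in> D"
  obtains c d W G where "c \<in> A" "d \<in> B" "x \<in> cdom c" "F x \<in> cdom d" "coord c x \<in> W" "local_rep D F c d W G"
  using bspec[OF assms(1)[unfolded smooth_map_iff] assms(2)] local_repD(3)[OF _ assms(2)] by metis

lemma local_rep_subset: "local_rep D F c d W G \<Longrightarrow> E \<subseteq> D \<Longrightarrow> local_rep E F c d W G"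
  unfolding local_rep_def by auto

lemma smooth_map_subset:
  assumes "smooth_map A B D F" "E \<subseteq> D"
  shows "smooth_map A B E F"
proof (rule smooth_mapI)
  fix x assume "x \<in> E"
  then have "x \<in> D" using assms(2) by blast
  then obtain c d W G where W: "c \<in> A" "d \<in> B" "x \<in> cdom c" "coord c x \<in> W" "local_rep D F c d W G"
    by (rule smooth_mapE[OF assms(1)])
  from local_rep_subset[OF W(5) assms(2)] W(1-4)
  show "\<exists>c\<in>A. \<exists>d\<in>B. x \<in> cdom c \<and> (\<exists>W G. coord c x \<in> W \<and> local_rep E F c d W G)" by metis
qed

lemma smooth_map_in_charts:
  fixes A :: "('x, 'a::euclidean_space) chart set" and B :: "('y, 'b::euclidean_space) chart set"
  assumes "smooth_atlas A" "smooth_atlas B" "smooth_map A B D F"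
    and "x \<in> D" "c \<in> A" "d \<in> B" "x \<in> cdom c" "F x \<in> cdom d"
  obtains W G where "coord c x \<in> W" "local_rep D F c d W G"
proof -
  obtain c' d' W' G' where 1: "c' \<in> A" "d' \<in> B" "x \<in> cdom c'" "F x \<in> cdom d'" "coord c' x \<in> W'"
    and rep: "local_rep D F c' d' W' G'"
    by (rule smooth_mapE[OF assms(3,4)])
  note 2 = local_repD[OF rep]
  let ?X = "coord c ` (cdom c \<inter> cdom c')" and ?Y = "coord d' ` (cdom d' \<inter> cdom d)"
  note tc = smooth_atlasD[OF assms(1) assms(5) 1(1)] and td = smooth_atlasD[OF assms(2) 1(2) assms(6)]
  define W1 where "W1 = {z \<in> ?X. trans_map c c' z \<in> W'}"
  have W1: "open W1" unfolding W1_def by (rule open_vimage_smooth_on[OF tc(3) tc(2) 2(1)])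
  have s1: "smooth_on W1 (\<lambda>z. G' (trans_map c c' z))"
    by (rule smooth_on_compose[OF W1 2(2) smooth_on_subset[OF tc(3)]]) (auto simp: W1_def)
  define W where "W = {z \<in> W1. G' (trans_map c c' z) \<in> ?Y}"
  have W: "open W" unfolding W_def by (rule open_vimage_smooth_on[OF s1 W1 td(2)])
  have s: "smooth_on W (\<lambda>z. trans_map d' d (G' (trans_map c c' z)))"
    by (rule smooth_on_compose[OF W td(3) smooth_on_subset[OF s1]]) (auto simp: W_def)
  have tx: "trans_map c c' (coord c x) = coord c' x" by (rule trans_map_coord[OF assms(1,5,7)])
  have "coord c x \<in> ?X" "coord d' (F x) \<in> ?Y" using assms(7,8) 1(3,4) by auto
  then have xW: "coord c x \<in> W"
    using 2(4)[OF assms(4) 1(3,5)] 1(5) by (simp add: W_def W1_def tx)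
  have "local_rep D F c d W (\<lambda>z. trans_map d' d (G' (trans_map c c' z)))"
    unfolding local_rep_def
  proof (intro conjI W s ballI impI)
    fix y assume "y \<in> D \<inter> cdom c" and y3: "coord c y \<in> W"
    then have y: "y \<in> D" "y \<in> cdom c" by auto
    \<comment> \<open>Injectivity of the chart turns a statement about coordinates into one about
      the point.\<close>
    have yc: "y \<in> cdom c'"
      using coord_in_imageD[OF assms(1,5) y(2)] y3 unfolding W_def W1_def by blast
    have t: "trans_map c c' (coord c y) = coord c' y" by (rule trans_map_coord[OF assms(1,5) y(2)])
    have yW: "coord c' y \<in> W'" using y3 unfolding W_def W1_def by (simp add: t)
    note F = 2(3,4)[OF y(1) yc yW]
    have "coord d' (F y) \<in> ?Y" using y3 F unfolding W_def by (simp add: t)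
    then show "F y \<in> cdom d" using coord_in_imageD[OF assms(2) 1(2) F(1)] by blast
    show "coord d (F y) = trans_map d' d (G' (trans_map c c' (coord c y)))"
      using trans_map_coord[OF assms(2) 1(2) F(1)] F(2) t by simp
  qed
  with xW show thesis by (rule that)
qed

lemma local_rep_compose:
  fixes c :: "('x, 'a::euclidean_space) chart" and d :: "('y, 'b::euclidean_space) chart"
    and e :: "('z, 'c::euclidean_space) chart"
  assumes F: "local_rep D F c d W1 f" and G: "local_rep E G d e W2 g" and FE: "F ` D \<subseteq> E"
  shows "local_rep D (\<lambda>x. G (F x)) c e {z \<in> W1. f z \<in> W2} (\<lambda>z. g (f z))"
  unfolding local_rep_def
proof (intro conjI ballI impI)
  show W: "open {z \<in> W1. f z \<in> W2}"
    by (rule open_vimage_smooth_on[OF local_repD(2,1)[OF F] local_repD(1)[OF G]])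
  show "smooth_on {z \<in> W1. f z \<in> W2} (\<lambda>z. g (f z))"
    by (rule smooth_on_compose[OF W local_repD(2)[OF G] smooth_on_subset[OF local_repD(2)[OF F]]]) auto
next
  fix y assume "y \<in> D \<inter> cdom c" "coord c y \<in> {z \<in> W1. f z \<in> W2}"
  then have y: "y \<in> D" "y \<in> cdom c" "coord c y \<in> W1" "f (coord c y) \<in> W2" by auto
  note Fy = local_repD(3,4)[OF F y(1,2,3)]
  have FyE: "F y \<in> E" and W2: "coord d (F y) \<in> W2" using FE y(1,4) Fy by auto
  show "G (F y) \<in> cdom e" "coord e (G (F y)) = g (f (coord c y))"
    using local_repD(3,4)[OF G FyE Fy(1) W2] Fy(2) by auto
qed

lemma smooth_map_compose:
  fixes A :: "('x, 'a::euclidean_space) chart set" and B :: "('y, 'b::euclidean_space) chart set"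
    and C :: "('z, 'c::euclidean_space) chart set"
  assumes "smooth_atlas A" "smooth_atlas B" "smooth_atlas C"
    and F: "smooth_map A B D F" and G: "smooth_map B C E G" and FE: "F ` D \<subseteq> E"
  shows "smooth_map A C D (\<lambda>x. G (F x))"
proof (rule smooth_mapI)
  fix x assume x: "x \<in> D"
  obtain c where c: "c \<in> A" "x \<in> cdom c" by (rule smooth_mapE[OF F x])
  have FxE: "F x \<in> E" using x FE by auto
  obtain d e W2 g where d: "d \<in> B" "F x \<in> cdom d" "e \<in> C" "coord d (F x) \<in> W2"
    and g: "local_rep E G d e W2 g"
    by (rule smooth_mapE[OF G FxE])
  obtain W1 f where 1: "coord c x \<in> W1" and f: "local_rep D F c d W1 f"
    by (rule smooth_map_in_charts[OF assms(1,2) F x c(1) d(1) c(2) d(2)])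
  have "coord c x \<in> {z \<in> W1. f z \<in> W2}" using 1 d(4) local_repD(4)[OF f x c(2) 1] by simp
  with local_rep_compose[OF f g FE] c d(3)
  show "\<exists>c\<in>A. \<exists>e\<in>C. x \<in> cdom c \<and> (\<exists>W h. coord c x \<in> W \<and> local_rep D (\<lambda>x. G (F x)) c e W h)"
    by metis
qed

text \<open>The identity chart exists on every Euclidean space, so that besides intervals also
  \<open>real \<times> 'e\<close> can parametrize a family of null rays.\<close>

definition flat_chart :: "('a, 'a::euclidean_space) chart" where
  "flat_chart = (UNIV, \<lambda>x. x)"

definition flat_atlas :: "('a, 'a::euclidean_space) chart set" where
  "flat_atlas = {flat_chart}"

lemma flat_chart_simps [simp]: "cdom flat_chart = UNIV" "coord flat_chart x = x"
  by (simp_all add: flat_chart_def)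

lemma real_atlas_eq: "real_atlas = flat_atlas"
  by (simp add: real_atlas_def flat_atlas_def flat_chart_def)

lemma smooth_atlas_flat: "smooth_atlas (flat_atlas :: ('a, 'a::euclidean_space) chart set)"
proof -
  have "trans_map flat_chart flat_chart = (\<lambda>x::'a. x)"
    by (auto simp: trans_map_def cinv_def inv_into_def flat_chart_def)
  then show ?thesis
    unfolding smooth_atlas_def flat_atlas_def by (simp add: smooth_on_id inj_on_def)
qed

lemma smooth_map_flat_chart:
  fixes B :: "('y, 'b::euclidean_space) chart set" and F :: "'a::euclidean_space \<Rightarrow> 'y"
  assumes "smooth_atlas B" "smooth_map flat_atlas B D F" "x \<in> D" "d \<in> B" "F x \<in> cdom d"
  obtains W G where "x \<in> W" "local_rep D F flat_chart d W G"
proof -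
  have "flat_chart \<in> flat_atlas" "x \<in> cdom flat_chart" by (simp_all add: flat_atlas_def)
  from smooth_map_in_charts[OF smooth_atlas_flat assms(1,2,3) this(1) assms(4) this(2) assms(5)]
  show thesis using that by (metis flat_chart_simps(2))
qed

text \<open>On an open domain the extension \<open>G\<close> agrees with the coordinate expression
  near the point, so the latter can itself be differentiated. This is how curves get
  velocities.\<close>

lemma smooth_map_flat_open:
  fixes B :: "('y, 'b::euclidean_space) chart set" and F :: "'a::euclidean_space \<Rightarrow> 'y"
  assumes "smooth_atlas B" "smooth_map flat_atlas B D F" "open D" "x \<in> D" "d \<in> B" "F x \<in> cdom d"
  obtains W where "open W" "x \<in> W" "W \<subseteq> D" "F ` W \<subseteq> cdom d" "smooth_on W (\<lambda>z. coord d (F z))"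
proof -
  obtain W G where x: "x \<in> W" and rep: "local_rep D F flat_chart d W G"
    by (rule smooth_map_flat_chart[OF assms(1,2,4,5,6)])
  note W = local_repD[OF rep]
  show thesis
  proof (rule that[of "W \<inter> D"])
    show "smooth_on (W \<inter> D) (\<lambda>z. coord d (F z))"
      by (rule smooth_on_cong[OF _ smooth_on_subset[OF W(2)]]) (use W assms(3) in auto)
  qed (use x W assms(3,4) in auto)
qed

lemma smooth_map_flatI:
  assumes "\<And>x. x \<in> D \<Longrightarrow> \<exists>d\<in>B. \<exists>W G. x \<in> W \<and> local_rep D F flat_chart d W G"
  shows "smooth_map flat_atlas B D F"
  by (rule smooth_mapI) (use assms in \<open>simp add: flat_atlas_def\<close>)

lemma smooth_map_const:
  assumes "d \<in> B" "a \<in> cdom d"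
  shows "smooth_map flat_atlas B D (\<lambda>x. a)"
proof (rule smooth_map_flatI)
  fix x
  have "local_rep D (\<lambda>x. a) flat_chart d UNIV (\<lambda>x. coord d a)"
    using assms(2) by (simp add: local_rep_def smooth_on_const)
  then show "\<exists>d\<in>B. \<exists>W G. x \<in> W \<and> local_rep D (\<lambda>x. a) flat_chart d W G"
    using assms(1) by blast
qed

lemma smooth_map_flat_flat:
  assumes "open W" "smooth_on W G" "D \<subseteq> W"
  shows "smooth_map flat_atlas flat_atlas D G"
proof (rule smooth_map_flatI)
  fix x assume "x \<in> D"
  moreover have "local_rep D G flat_chart flat_chart W G"
    using assms by (simp add: local_rep_def)
  ultimately show "\<exists>d\<in>flat_atlas. \<exists>W' G'. x \<in> W' \<and> local_rep D G flat_chart d W' G'"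
    using assms(3) by (auto simp: flat_atlas_def)
qed

lemma smooth_structure_atlas:
  assumes "smooth_structure A"
  shows "smooth_atlas A"
  unfolding smooth_atlas_def
proof (intro conjI ballI)
  fix c assume c: "c \<in> A"
  then have hom: "homeomorphism (cdom c) (coord c ` cdom c) (coord c) (cinv c)"
    and op: "open (coord c ` cdom c)"
    using assms by (auto simp: smooth_structure_def is_chart_def)
  show "inj_on (coord c) (cdom c)"
    using hom by (intro inj_on_inverseI[of _ "cinv c"]) (simp add: homeomorphism_def)
  fix d assume d: "d \<in> A"
  then have "open (cdom d)"
    using assms by (auto simp: smooth_structure_def is_chart_def)
  \<comment> \<open>Seen in coordinates, the overlap is a preimage under the continuous inverse
    chart, hence open.\<close>
  moreover have "coord c ` (cdom c \<inter> cdom d) = coord c ` cdom c \<inter> cinv c -` cdom d"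
    using hom by (force simp: homeomorphism_def)
  ultimately show "open (coord c ` (cdom c \<inter> cdom d))"
    using continuous_open_preimage[OF homeomorphism_cont2[OF hom] op] by simp
  show "smooth_on (coord c ` (cdom c \<inter> cdom d)) (trans_map c d)"
    using assms c d by (auto simp: smooth_structure_def compatible_def)
qed

lemma smooth_structure_chart:
  assumes "smooth_structure A"
  obtains c where "c \<in> A" "p \<in> cdom c"
  using assms unfolding smooth_structure_def by blast

section \<open>Tangent vectors in charts\<close>

abbreviation jac :: "('x, 'e::euclidean_space) chart \<Rightarrow> ('x, 'e) chart \<Rightarrow> 'x \<Rightarrow> 'e \<Rightarrow> 'e" where
  "jac c d p \<equiv> frechet_derivative (trans_map c d) (at (coord c p))"

lemma jac_has_derivative:
  assumes "smooth_atlas A" "c \<in> A" "d \<in> A" "p \<in> cdom c" "p \<in> cdom d"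
  shows "(trans_map c d has_derivative jac c d p) (at (coord c p))"
  by (rule smooth_onD(1)[OF smooth_atlasD(3)[OF assms(1-3)]]) (use assms(4,5) in blast)

lemma jac_linear:
  assumes "smooth_atlas A" "c \<in> A" "d \<in> A" "p \<in> cdom c" "p \<in> cdom d"
  shows "linear (jac c d p)"
  using jac_has_derivative[OF assms] has_derivative_linear by blast

lemma jac_self:
  assumes "smooth_atlas A" "c \<in> A" "p \<in> cdom c"
  shows "jac c c p u = u"
proof -
  have "((\<lambda>z. z) has_derivative jac c c p) (at (coord c p))"
    by (rule has_derivative_transform_within_open[OF jac_has_derivative[OF assms(1,2,2,3,3)]
          smooth_atlasD(2)[OF assms(1,2,2)]])
      (use assms(3) trans_map_coord[OF assms(1,2), of _ c] in auto)
  then show ?thesis using has_derivative_unique[OF has_derivative_ident] by metis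
qed

text \<open>The chain rule for the cocycle of transition maps. It makes \<open>tvec_of\<close> a
  coherent family, so every model vector occurs as a component of a tangent vector.\<close>

lemma jac_chain:
  assumes "smooth_atlas A" "c \<in> A" "d \<in> A" "e \<in> A" "p \<in> cdom c" "p \<in> cdom d" "p \<in> cdom e"
  shows "jac d e p (jac c d p u) = jac c e p u"
proof -
  have "((\<lambda>z. trans_map d e (trans_map c d z)) has_derivative (\<lambda>u. jac d e p (jac c d p u))) (at (coord c p))"
    by (rule has_derivative_compose[OF jac_has_derivative[OF assms(1,2,3,5,6)]])
      (use jac_has_derivative[OF assms(1,3,4,6,7)] trans_map_coord[OF assms(1,2,5)] in simp)
  then have "(trans_map c e has_derivative (\<lambda>u. jac d e p (jac c d p u))) (at (coord c p))"
    by (rule has_derivative_transform_within_open[OF _ smooth_atlasD(2)[OF assms(1,2,3)]])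
      (use assms(5,6) trans_map_coord[OF assms(1,2), of _ d] trans_map_coord[OF assms(1,2), of _ e]
        trans_map_coord[OF assms(1,3), of _ e] in auto)
  from has_derivative_unique[OF this jac_has_derivative[OF assms(1,2,4,5,7)]]
  show ?thesis by metis
qed

lemma tangent_spaceD:
  assumes "v \<in> tangent_space A p"
  shows "c \<in> A \<Longrightarrow> d \<in> A \<Longrightarrow> p \<in> cdom c \<Longrightarrow> p \<in> cdom d \<Longrightarrow> v d = jac c d p (v c)"
    and "c \<notin> A \<or> p \<notin> cdom c \<Longrightarrow> v c = 0"
  using assms unfolding tangent_space_def by blast+

lemma tangent_spaceI:
  assumes "\<And>c d. c \<in> A \<Longrightarrow> d \<in> A \<Longrightarrow> p \<in> cdom c \<Longrightarrow> p \<in> cdom d \<Longrightarrow> v d = jac c d p (v c)"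
    and "\<And>c. c \<notin> A \<or> p \<notin> cdom c \<Longrightarrow> v c = 0"
  shows "v \<in> tangent_space A p"
  unfolding tangent_space_def using assms by blast

lemma tvec_of_self:
  assumes "smooth_atlas A" "c \<in> A" "p \<in> cdom c"
  shows "tvec_of A c p u c = u"
  using assms by (simp add: tvec_of_def jac_self)

lemma tvec_of_in_tangent_space:
  assumes "smooth_atlas A" "c \<in> A" "p \<in> cdom c"
  shows "tvec_of A c p u \<in> tangent_space A p"
  by (rule tangent_spaceI) (auto simp: tvec_of_def jac_chain[OF assms(1,2) _ _ assms(3)])

lemma tvec_of_component:
  assumes "v \<in> tangent_space A p" "c \<in> A" "p \<in> cdom c"
  shows "tvec_of A c p (v c) = v"
proof
  fix d show "tvec_of A c p (v c) d = v d"
    using tangent_spaceD(1)[OF assms(1,2) _ assms(3)] tangent_spaceD(2)[OF assms(1), of d]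
    by (simp add: tvec_of_def)
qed

lemma tscale_in_tangent_space:
  assumes "smooth_atlas A" "v \<in> tangent_space A p"
  shows "tscale r v \<in> tangent_space A p"
proof (rule tangent_spaceI)
  fix c d assume *: "c \<in> A" "d \<in> A" "p \<in> cdom c" "p \<in> cdom d"
  show "r *\<^sub>R v d = jac c d p (r *\<^sub>R v c)"
    using tangent_spaceD(1)[OF assms(2) *] linear_scale[OF jac_linear[OF assms(1) *]] by metis
next
  fix c assume "c \<notin> A \<or> p \<notin> cdom c"
  then show "r *\<^sub>R v c = 0" using tangent_spaceD(2)[OF assms(2)] by simp
qed

lemma add_in_tangent_space:
  assumes "smooth_atlas A" "v \<in> tangent_space A p" "w \<in> tangent_space A p"
  shows "(\<lambda>c. v c + w c) \<in> tangent_space A p"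
proof (rule tangent_spaceI)
  fix c d assume *: "c \<in> A" "d \<in> A" "p \<in> cdom c" "p \<in> cdom d"
  show "v d + w d = jac c d p (v c + w c)"
    using tangent_spaceD(1)[OF assms(2) *] tangent_spaceD(1)[OF assms(3) *]
      linear_add[OF jac_linear[OF assms(1) *]] by metis
next
  fix c assume "c \<notin> A \<or> p \<notin> cdom c"
  then show "v c + w c = 0" using tangent_spaceD(2)[OF assms(2)] tangent_spaceD(2)[OF assms(3)] by simp
qed

definition tchart :: "('m, 'e::euclidean_space) chart set \<Rightarrow> ('m, 'e) chart \<Rightarrow> ('m \<times> ('m, 'e) tvec, 'e \<times> 'e) chart" where
  "tchart A c = ({(p, v). p \<in> cdom c \<and> v \<in> tangent_space A p}, \<lambda>(p, v). (coord c p, v c))"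

lemma tangent_atlas_eq: "tangent_atlas A = tchart A ` A"
  by (simp add: tangent_atlas_def tchart_def)

lemma tchart_in: "c \<in> A \<Longrightarrow> tchart A c \<in> tangent_atlas A"
  by (simp add: tangent_atlas_eq)

lemma tchart_simps [simp]:
  "(p, v) \<in> cdom (tchart A c) \<longleftrightarrow> p \<in> cdom c \<and> v \<in> tangent_space A p"
  "coord (tchart A c) (p, v) = (coord c p, v c)"
  by (simp_all add: tchart_def)

text \<open>If \<tau> is the transition map of the base, then that of the tangent charts is
  \<open>(x, u) \<mapsto> (\<tau> x, \<tau>' x u)\<close>, defined on an open set times the whole
  model space.\<close>

lemma smooth_atlas_tangent:
  assumes A: "smooth_atlas A"
  shows "smooth_atlas (tangent_atlas A)"
proof -
  have inj: "inj_on (coord (tchart A c)) (cdom (tchart A c))" if "c \<in> A" for c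
  proof (rule inj_onI, clarsimp)
    fix p v q w
    assume *: "p \<in> cdom c" "v \<in> tangent_space A p" "q \<in> cdom c" "w \<in> tangent_space A q"
      "coord c p = coord c q" "v c = w c"
    then have "p = q" using smooth_atlasD(1)[OF A that that] by (auto dest: inj_onD)
    then show "p = q \<and> v = w" using * tvec_of_component that by metis
  qed
  have image: "coord (tchart A c) ` (cdom (tchart A c) \<inter> cdom (tchart A d)) =
      coord c ` (cdom c \<inter> cdom d) \<times> UNIV" if "c \<in> A" for c d
  proof (intro equalityI subsetI)
    fix z assume "z \<in> coord c ` (cdom c \<inter> cdom d) \<times> (UNIV :: 'b set)"
    then obtain p u where "z = (coord c p, u)" "p \<in> cdom c" "p \<in> cdom d" by auto
    then show "z \<in> coord (tchart A c) ` (cdom (tchart A c) \<inter> cdom (tchart A d))"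
      using tvec_of_in_tangent_space[OF A that] tvec_of_self[OF A that]
      by (intro image_eqI[of _ _ "(p, tvec_of A c p u)"]) auto
  qed auto
  have "smooth_on (coord c ` (cdom c \<inter> cdom d) \<times> UNIV) (trans_map (tchart A c) (tchart A d))"
    if c: "c \<in> A" and d: "d \<in> A" for c d
  proof -
    note cd = smooth_atlasD(2,3)[OF A c d]
    let ?X = "coord c ` (cdom c \<inter> cdom d) \<times> (UNIV :: 'b set)"
    have X: "open ?X" using cd(1) by (intro open_Times) auto
    have id: "smooth_on ?X (\<lambda>z. z)" by (rule smooth_on_id[OF X])
    have "smooth_on ?X (\<lambda>z. (trans_map c d (fst z), frechet_derivative (trans_map c d) (at (fst z)) (snd z)))"
      by (intro smooth_on_Pair X smooth_on_compose[OF _ cd(2)] smooth_on_derivative_apply[OF _ cd(2)]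
        smooth_on_fst smooth_on_snd id) auto
    then show ?thesis
    proof (rule smooth_on_cong[OF X])
      fix z assume "z \<in> ?X"
      then obtain p u where z: "z = (coord c p, u)" "p \<in> cdom c" "p \<in> cdom d" by auto
      let ?v = "tvec_of A c p u"
      have v: "?v \<in> tangent_space A p" "?v c = u"
        by (fact tvec_of_in_tangent_space[OF A c z(2)], fact tvec_of_self[OF A c z(2)])
      have "cinv (tchart A c) (coord (tchart A c) (p, ?v)) = (p, ?v)"
        unfolding cinv_def by (rule inv_into_f_f[OF inj[OF c]]) (use v z in auto)
      then have "trans_map (tchart A c) (tchart A d) z = (coord d p, ?v d)"
        using v z by (simp add: trans_map_def)
      then show "(trans_map c d (fst z), frechet_derivative (trans_map c d) (at (fst z)) (snd z)) =
          trans_map (tchart A c) (tchart A d) z"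
        using z trans_map_coord[OF A c z(2)] d by (simp add: tvec_of_def)
    qed
  qed
  then show ?thesis
    using inj image smooth_atlasD(2)[OF A]
    by (auto simp: smooth_atlas_def tangent_atlas_eq intro!: open_Times)
qed

lemma smooth_map_fst:
  assumes "smooth_structure A"
  shows "smooth_map (tangent_atlas A) A {(p, v). v \<in> tangent_space A p} fst"
proof (rule smooth_mapI, clarify)
  fix p v assume v: "v \<in> tangent_space A p"
  obtain c where c: "c \<in> A" "p \<in> cdom c" by (rule smooth_structure_chart[OF assms])
  have "local_rep {(p, v). v \<in> tangent_space A p} fst (tchart A c) c UNIV fst"
    unfolding local_rep_def by (auto intro: smooth_on_fst[OF open_UNIV smooth_on_id[OF open_UNIV]])
  then show "\<exists>c\<in>tangent_atlas A. \<exists>d\<in>A. (p, v) \<in> cdom c \<and>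
      (\<exists>W G. coord c (p, v) \<in> W \<and> local_rep {(p, v). v \<in> tangent_space A p} fst c d W G)"
    using c v tchart_in[OF c(1)] by (intro bexI[of _ "tchart A c"] bexI[of _ c]) auto
qed

lemma smooth_map_tscale:
  fixes D :: "'z::euclidean_space set"
  assumes A: "smooth_atlas A" and "smooth_map flat_atlas (tangent_atlas A) D (\<lambda>z. (q z, v z))"
    and r: "smooth_on UNIV r"
  shows "smooth_map flat_atlas (tangent_atlas A) D (\<lambda>z. (q z, tscale (r z) (v z)))"
proof (rule smooth_map_flatI)
  fix x assume x: "x \<in> D"
  obtain T where "T \<in> tangent_atlas A" "(q x, v x) \<in> cdom T"
    by (rule smooth_mapE[OF assms(2) x])
  then obtain c where c: "c \<in> A" "(q x, v x) \<in> cdom (tchart A c)" by (auto simp: tangent_atlas_eq)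
  obtain W G where W: "x \<in> W" and rep: "local_rep D (\<lambda>z. (q z, v z)) flat_chart (tchart A c) W G"
    by (rule smooth_map_flat_chart[OF smooth_atlas_tangent[OF A] assms(2) x tchart_in[OF c(1)] c(2)])
  note G = local_repD[OF rep]
  have "local_rep D (\<lambda>z. (q z, tscale (r z) (v z))) flat_chart (tchart A c) W
      (\<lambda>z. (fst (G z), r z *\<^sub>R snd (G z)))"
    unfolding local_rep_def
  proof (intro conjI ballI impI G(1))
    show "smooth_on W (\<lambda>z. (fst (G z), r z *\<^sub>R snd (G z)))"
      by (intro smooth_on_Pair smooth_on_scaleR smooth_on_fst smooth_on_snd G(1,2) smooth_on_subset[OF r]) auto
    fix y assume "y \<in> D \<inter> cdom flat_chart" "coord flat_chart y \<in> W"
    then have y: "(q y, v y) \<in> cdom (tchart A c)" "(coord c (q y), v y c) = G y"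
      using G(3,4)[of y] by auto
    show "(q y, tscale (r y) (v y)) \<in> cdom (tchart A c)"
      using y(1) by (simp add: tscale_in_tangent_space[OF A])
    show "coord (tchart A c) (q y, tscale (r y) (v y)) =
        (fst (G (coord flat_chart y)), r (coord flat_chart y) *\<^sub>R snd (G (coord flat_chart y)))"
      by (simp flip: y(2))
  qed
  with W show "\<exists>d\<in>tangent_atlas A. \<exists>W G. x \<in> W \<and>
      local_rep D (\<lambda>z. (q z, tscale (r z) (v z))) flat_chart d W G"
    using tchart_in[OF c(1)] by blast
qed

lemma curve_derivative:
  assumes A: "smooth_atlas A" and "smooth_map flat_atlas A I \<gamma>" "open I" "t \<in> I"
    and "c \<in> A" "\<gamma> t \<in> cdom c"
  shows "((\<lambda>s. coord c (\<gamma> s)) has_vector_derivative velocity A \<gamma> t c) (at t)"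
proof -
  obtain W where "open W" "t \<in> W" "smooth_on W (\<lambda>s. coord c (\<gamma> s))"
    by (rule smooth_map_flat_open[OF assms])
  then have "(\<lambda>s. coord c (\<gamma> s)) differentiable at t"
    using smooth_onD(1) by (metis differentiableI)
  then show ?thesis
    using assms(5,6) by (simp add: velocity_def vector_derivative_works o_def)
qed

lemma velocity_in_tangent_space:
  assumes A: "smooth_atlas A" and "smooth_map flat_atlas A I \<gamma>" "open I" "t \<in> I"
  shows "velocity A \<gamma> t \<in> tangent_space A (\<gamma> t)"
proof -
  have "velocity A \<gamma> t d = jac c d (\<gamma> t) (velocity A \<gamma> t c)"
    if c: "c \<in> A" "d \<in> A" "\<gamma> t \<in> cdom c" "\<gamma> t \<in> cdom d" for c d
  proof -
    have dc: "((\<lambda>s. coord c (\<gamma> s)) has_vector_derivative velocity A \<gamma> t c) (at t)"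
      and dd: "((\<lambda>s. coord d (\<gamma> s)) has_vector_derivative velocity A \<gamma> t d) (at t)"
      using curve_derivative[OF assms] c by auto
    obtain W where W: "open W" "t \<in> W" "\<gamma> ` W \<subseteq> cdom c"
      by (rule smooth_map_flat_open[OF assms c(1,3)])
    have "((\<lambda>s. trans_map c d (coord c (\<gamma> s))) has_derivative
        (\<lambda>r. jac c d (\<gamma> t) (r *\<^sub>R velocity A \<gamma> t c))) (at t)"
      by (rule has_derivative_compose[OF dc[unfolded has_vector_derivative_def]])
        (rule jac_has_derivative[OF A c])
    then have "((\<lambda>s. coord d (\<gamma> s)) has_derivative (\<lambda>r. jac c d (\<gamma> t) (r *\<^sub>R velocity A \<gamma> t c))) (at t)"
      by (rule has_derivative_transform_within_open[OF _ W(1,2)])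
        (use W(3) trans_map_coord[OF A c(1), of _ d] in auto)
    from fun_cong[OF has_derivative_unique[OF this dd[unfolded has_vector_derivative_def]], of 1]
    show ?thesis by simp
  qed
  then show ?thesis
  proof (rule tangent_spaceI)
    fix c assume "c \<notin> A \<or> \<gamma> t \<notin> cdom c"
    then show "velocity A \<gamma> t c = 0" by (auto simp: velocity_def)
  qed
qed

lemma sub_tangentE:
  assumes "X \<in> sub_tangent A N x"
  obtains \<gamma> \<epsilon> where "\<epsilon> > 0" "smooth_map flat_atlas A {-\<epsilon><..<\<epsilon>} \<gamma>" "\<gamma> ` {-\<epsilon><..<\<epsilon>} \<subseteq> N"
    "\<gamma> 0 = x" "velocity A \<gamma> 0 = X"
  using assms unfolding sub_tangent_def curve_in_def real_atlas_eq by blast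

lemma sub_tangent_subset:
  assumes "smooth_atlas A"
  shows "sub_tangent A N x \<subseteq> tangent_space A x"
proof
  fix X assume "X \<in> sub_tangent A N x"
  then obtain \<gamma> \<epsilon> where *: "\<epsilon> > 0" "smooth_map flat_atlas A {-\<epsilon><..<\<epsilon>} \<gamma>" "\<gamma> 0 = x" "velocity A \<gamma> 0 = X"
    by (rule sub_tangentE)
  show "X \<in> tangent_space A x"
    using velocity_in_tangent_space[OF assms *(2), of 0] *(1,3,4) by simp
qed

section \<open>The metric in components, isotropic vectors, and maps applied to curves of zero
  velocity\<close>

lemma metric_in_component:
  assumes "c \<in> A" "p \<in> cdom c" "v \<in> tangent_space A p" "w \<in> tangent_space A p"
  shows "g p v w = metric_in A g c p (v c) (w c)"
  using assms by (simp add: metric_in_def tvec_of_component)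

lemma lorentzian_metric_form:
  assumes "lorentzian_metric A g" "c \<in> A" "p \<in> cdom c"
  shows "lorentz_form (metric_in A g c p)"
  using assms by (simp add: lorentzian_metric_def)

text \<open>In coordinates that diagonalize \<open>B\<close>, an isotropic vector without time
  component has vanishing sum of squares and is therefore zero. The hypotheses make the whole span
  of \<open>u\<close> and \<open>v\<close> isotropic, and some nontrivial combination of two vectors
  has no time component.\<close>

lemma lorentz_form_isotropic_pair:
  assumes "lorentz_form B" and 0: "B u u = 0" "B u v = 0" "B v v = 0"
  shows "\<exists>a b. (a, b) \<noteq> (0, 0) \<and> a *\<^sub>R u + b *\<^sub>R v = 0"
proof -
  obtain E :: "'a \<Rightarrow> 'a" and b0 where bil: "bilinear B" and b0: "b0 \<in> Basis" and E: "linear E" "bij E"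
    and BE: "\<And>i j. i \<in> Basis \<Longrightarrow> j \<in> Basis \<Longrightarrow>
      B (E i) (E j) = (if i \<noteq> j then 0 else if i = b0 then -1 else 1)"
    using assms(1) unfolding lorentz_form_def by blast
  have diag: "B (E x) (E y) = (\<Sum>i\<in>Basis. (if i = b0 then -1 else 1) * (x \<bullet> i) * (y \<bullet> i))" for x y
  proof -
    have "linear (\<lambda>v. B v (E y))" "linear (B (E x))" for x y
      using bil by (simp_all add: bilinear_def)
    note lin = linear_compose[OF E(1) this(1), unfolded o_def] linear_compose[OF E(1) this(2), unfolded o_def]
    have "B (E x) (E y) = (\<Sum>i\<in>Basis. (x \<bullet> i) *\<^sub>R (\<Sum>j\<in>Basis. (y \<bullet> j) *\<^sub>R B (E i) (E j)))"
      using linear_eq_sum_Basis[OF lin(1), of x y] linear_eq_sum_Basis[OF lin(2), of _ y] by simp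
    also have "\<dots> = (\<Sum>i\<in>Basis. (x \<bullet> i) * (\<Sum>j\<in>Basis. if j = i then (if i = b0 then -1 else 1) * (y \<bullet> i) else 0))"
      unfolding real_scaleR_def
      by (intro sum.cong refl arg_cong2[where f = "(*)"]) (simp add: BE)
    finally show ?thesis by (simp add: mult_ac)
  qed
  have sq: "z = 0" if "B (E z) (E z) = 0" "z \<bullet> b0 = 0" for z
  proof -
    have "(\<Sum>i\<in>Basis. (z \<bullet> i)\<^sup>2) = B (E z) (E z)"
      unfolding diag using that(2) by (intro sum.cong refl) (auto simp: power2_eq_square)
    then have "\<forall>i\<in>Basis. z \<bullet> i = 0" using that(1) by (simp add: sum_nonneg_eq_0_iff)
    then show ?thesis by (simp add: euclidean_all_zero_iff)
  qed
  obtain x y where xy: "u = E x" "v = E y" using E(2) by (metis bij_pointE)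
  have Bl: "B (a *\<^sub>R p + b *\<^sub>R q) w = a * B p w + b * B q w"
    and Br: "B w (a *\<^sub>R p + b *\<^sub>R q) = a * B w p + b * B w q" for a b p q w
    using bil by (simp_all add: bilinear_ladd bilinear_radd bilinear_lmul bilinear_rmul)
  \<comment> \<open>Symmetry is not part of \<open>bilinear\<close>; it is read off from the
    diagonal form.\<close>
  have Bvu: "B v u = 0"
    using 0(2) unfolding xy diag by (simp add: mult_ac)
  have iso: "B (a *\<^sub>R u + b *\<^sub>R v) (a *\<^sub>R u + b *\<^sub>R v) = 0" for a b
    unfolding Bl Br using 0 Bvu by simp
  have E_comb: "a *\<^sub>R u + b *\<^sub>R v = E (a *\<^sub>R x + b *\<^sub>R y)" for a b
    unfolding xy using E(1) by (simp add: linear_add linear_scale)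
  have comb: "a *\<^sub>R u + b *\<^sub>R v = 0" if "(a *\<^sub>R x + b *\<^sub>R y) \<bullet> b0 = 0" for a b
    using sq[OF _ that] iso[of a b] E(1) linear_0 unfolding E_comb by metis
  show ?thesis
  proof (cases "x \<bullet> b0 = 0")
    case True
    with comb[of 1 0] show ?thesis by (intro exI[of _ 1] exI[of _ 0]) (simp add: inner_add_left)
  next
    case False
    \<comment> \<open>These coefficients cancel the time components of \<open>x\<close> and
      \<open>y\<close>, and the second one is nonzero in this case.\<close>
    then show ?thesis
      using comb[of "- (y \<bullet> b0)" "x \<bullet> b0"]
      by (intro exI[of _ "- (y \<bullet> b0)"] exI[of _ "x \<bullet> b0"]) (simp add: inner_add_left inner_diff_left)
  qed
qed

text \<open>The derivative of any local extension of \<open>F\<close> sends 0 to 0. With the inverse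
  exponential map as \<open>F\<close>, this proves velocities in the hypersurface to be
  nonzero.\<close>

lemma smooth_map_curve_zero:
  fixes B :: "('y, 'b::euclidean_space) chart set"
  assumes "smooth_atlas A" "smooth_atlas B" and F: "smooth_map A B E F"
    and \<alpha>: "smooth_map flat_atlas A I \<alpha>" "open I" "t \<in> I" "\<alpha> ` I \<subseteq> E"
    and d: "d \<in> A" "\<alpha> t \<in> cdom d" "velocity A \<alpha> t d = 0"
    and e: "e \<in> B" "F (\<alpha> t) \<in> cdom e"
  shows "((\<lambda>s. coord e (F (\<alpha> s))) has_vector_derivative 0) (at t)"
proof -
  have "\<alpha> t \<in> E" using \<alpha>(3,4) by auto
  then obtain W G where W: "coord d (\<alpha> t) \<in> W" and rep: "local_rep E F d e W G"
    using smooth_map_in_charts[OF assms(1,2) F _ d(1) e(1) d(2) e(2)] by blast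
  obtain T where T: "open T" "t \<in> T" "T \<subseteq> I" "\<alpha> ` T \<subseteq> cdom d" "smooth_on T (\<lambda>s. coord d (\<alpha> s))"
    by (rule smooth_map_flat_open[OF assms(1) \<alpha>(1-3) d(1,2)])
  have "((\<lambda>s. coord d (\<alpha> s)) has_derivative (\<lambda>r. r *\<^sub>R 0)) (at t)"
    using curve_derivative[OF assms(1) \<alpha>(1-3) d(1,2)] d(3) by (simp add: has_vector_derivative_def)
  from has_derivative_compose[OF this smooth_onD(1)[OF local_repD(2)[OF rep] W]]
  have "((\<lambda>s. G (coord d (\<alpha> s))) has_derivative
      (\<lambda>r. frechet_derivative G (at (coord d (\<alpha> t))) (r *\<^sub>R 0))) (at t)" .
  then have "((\<lambda>s. G (coord d (\<alpha> s))) has_vector_derivative 0) (at t)"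
    using linear_0[OF smooth_on_linear[OF local_repD(2)[OF rep] W]]
    by (simp add: has_vector_derivative_def)
  then show ?thesis
  proof (rule has_vector_derivative_transform_within_open)
    show "open {s \<in> T. coord d (\<alpha> s) \<in> W}"
      by (rule open_vimage_smooth_on[OF T(5,1) local_repD(1)[OF rep]])
    show "t \<in> {s \<in> T. coord d (\<alpha> s) \<in> W}" using T W by simp
    fix s assume "s \<in> {s \<in> T. coord d (\<alpha> s) \<in> W}"
    then show "G (coord d (\<alpha> s)) = coord e (F (\<alpha> s))"
      using local_repD(4)[OF rep, of "\<alpha> s"] T(3,4) \<alpha>(4) by (auto simp: image_subset_iff)
  qed
qed

section \<open>Covariant derivatives along curves\<close>

lemma field_derivative:
  assumes A: "smooth_atlas A" and W: "smooth_map flat_atlas (tangent_atlas A) I (\<lambda>s. (\<gamma> s, W s))"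
    and I: "open I" "t \<in> I" and c: "c \<in> A" "\<gamma> t \<in> cdom c"
  shows "W t \<in> tangent_space A (\<gamma> t)"
    and "((\<lambda>s. coord c (\<gamma> s)) has_vector_derivative velocity A \<gamma> t c) (at t)"
    and "((\<lambda>s. W s c) has_vector_derivative vector_derivative (\<lambda>s. W s c) (at t)) (at t)"
proof -
  obtain T where "T \<in> tangent_atlas A" "(\<gamma> t, W t) \<in> cdom T" by (rule smooth_mapE[OF W I(2)])
  then show ts: "W t \<in> tangent_space A (\<gamma> t)" by (auto simp: tangent_atlas_eq)
  have "(\<gamma> t, W t) \<in> cdom (tchart A c)" using ts c by simp
  then obtain O' where O': "open O'" "t \<in> O'" "smooth_on O' (\<lambda>s. coord (tchart A c) (\<gamma> s, W s))"
    by (rule smooth_map_flat_open[OF smooth_atlas_tangent[OF A] W I tchart_in[OF c(1)]])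
  then have "smooth_on O' (\<lambda>s. fst (coord c (\<gamma> s), W s c))" "smooth_on O' (\<lambda>s. snd (coord c (\<gamma> s), W s c))"
    by (intro smooth_on_fst smooth_on_snd; simp)+
  then have "(\<lambda>s. coord c (\<gamma> s)) differentiable at t" "(\<lambda>s. W s c) differentiable at t"
    using smooth_onD(1)[OF _ O'(2)] differentiableI by fastforce+
  then show "((\<lambda>s. coord c (\<gamma> s)) has_vector_derivative velocity A \<gamma> t c) (at t)"
    "((\<lambda>s. W s c) has_vector_derivative vector_derivative (\<lambda>s. W s c) (at t)) (at t)"
    using c by (simp_all add: velocity_def vector_derivative_works o_def)
qed

text \<open>Differentiating components along the curve brings in the second derivative of the
  transition map; the transformation law of \<open>\<Gamma>\<close> compensates for it
  exactly.\<close>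

lemma covd_in_tangent_space:
  fixes A :: "('m, 'e::euclidean_space) chart set"
  assumes A: "smooth_atlas A" and conn: "affine_connection A \<Gamma>"
    and \<gamma>: "smooth_map flat_atlas A I \<gamma>"
    and W: "smooth_map flat_atlas (tangent_atlas A) I (\<lambda>s. (\<gamma> s, W s))"
    and I: "open I" "t \<in> I"
  shows "covd A \<Gamma> \<gamma> W t \<in> tangent_space A (\<gamma> t)"
proof (rule tangent_spaceI)
  fix c assume "c \<notin> A \<or> \<gamma> t \<notin> cdom c"
  then show "covd A \<Gamma> \<gamma> W t c = 0" by (auto simp: covd_def)
next
  fix c d assume c: "c \<in> A" "d \<in> A" "\<gamma> t \<in> cdom c" "\<gamma> t \<in> cdom d"
  let ?X = "coord c ` (cdom c \<inter> cdom d)" and ?x = "coord c (\<gamma> t)" and ?J = "jac c d (\<gamma> t)"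
  let ?u = "velocity A \<gamma> t c" and ?w = "W t c" and ?w' = "vector_derivative (\<lambda>s. W s c) (at t)"
  \<comment> \<open>\<open>F (x, v)\<close> is the Jacobian at \<open>x\<close> applied to
    \<open>v\<close>, so the component of \<open>W\<close> in \<open>d\<close> is \<open>F\<close>
    along the pair of curves in \<open>c\<close>. The second derivative of the transition map is the
    partial derivative of \<open>F\<close> in the first slot.\<close>
  define F where "F = (\<lambda>z. frechet_derivative (trans_map c d) (at (fst z)) (snd z))"
  note X = smooth_atlasD(2,3)[OF A c(1,2)]
  have XU: "open (?X \<times> (UNIV :: 'e set))" using X(1) by (rule open_Times) simp
  have id: "smooth_on (?X \<times> (UNIV :: 'e set)) (\<lambda>z. z)" by (rule smooth_on_id[OF XU])
  have sF: "smooth_on (?X \<times> UNIV) F"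
    unfolding F_def by (intro smooth_on_derivative_apply[OF XU X(2)] smooth_on_fst smooth_on_snd XU id) auto
  obtain F' where F': "(F has_derivative F') (at (?x, ?w))"
    using smooth_onD(1)[OF sF, of "(?x, ?w)"] c(3,4) by blast
  note fc = field_derivative[OF A W I c(1,3)]
  have 1: "((\<lambda>y. F (y, ?w)) has_derivative (\<lambda>h. F' (h, 0))) (at ?x)"
    by (rule has_derivative_compose[where f = "\<lambda>y. (y, ?w)", OF _ F'])
      (auto intro!: derivative_eq_intros)
  have "((\<lambda>v. F (?x, v)) has_derivative (\<lambda>h. F' (0, h))) (at ?w)"
    by (rule has_derivative_compose[where f = "\<lambda>v. (?x, v)", OF _ F'])
      (auto intro!: derivative_eq_intros)
  \<comment> \<open>\<open>F\<close> is linear in its second slot, so the partial derivative there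
    is the Jacobian itself.\<close>
  moreover have "((\<lambda>v. F (?x, v)) has_derivative ?J) (at ?w)"
    unfolding F_def fst_conv snd_conv
    using jac_linear[OF A c] by (intro bounded_linear_imp_has_derivative) (simp add: linear_conv_bounded_linear)
  ultimately have 2: "F' (0, h) = ?J h" for h
    using has_derivative_unique by metis
  have lF': "linear F'" using F' has_derivative_linear by blast
  have sum: "F' (?u, ?w') = F' (?u, 0) + ?J ?w'"
    using linear_add[OF lF', of "(?u, 0)" "(0, ?w')"] 2 by simp
  have "((\<lambda>s. (coord c (\<gamma> s), W s c)) has_derivative (\<lambda>r. (r *\<^sub>R ?u, r *\<^sub>R ?w'))) (at t)"
    using fc(2,3) unfolding has_vector_derivative_def by (rule has_derivative_Pair)
  from has_derivative_compose[OF this F']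
  have "((\<lambda>s. F (coord c (\<gamma> s), W s c)) has_derivative (\<lambda>r. F' (r *\<^sub>R ?u, r *\<^sub>R ?w'))) (at t)" .
  moreover have "F' (r *\<^sub>R ?u, r *\<^sub>R ?w') = r *\<^sub>R F' (?u, ?w')" for r
    using linear_scale[OF lF', of r "(?u, ?w')"] by simp
  ultimately have dF: "((\<lambda>s. F (coord c (\<gamma> s), W s c)) has_vector_derivative F' (?u, ?w')) (at t)"
    by (simp add: has_vector_derivative_def)
  obtain T where T: "open T" "t \<in> T" "T \<subseteq> I" "\<gamma> ` T \<subseteq> cdom c"
    by (rule smooth_map_flat_open[OF A \<gamma> I c(1,3)])
  obtain T' where T': "open T'" "t \<in> T'" "T' \<subseteq> I" "\<gamma> ` T' \<subseteq> cdom d"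
    by (rule smooth_map_flat_open[OF A \<gamma> I c(2,4)])
  have Fd: "F (coord c (\<gamma> s), W s c) = W s d" if s: "s \<in> T \<inter> T'" for s
  proof -
    have "s \<in> I" "\<gamma> s \<in> cdom c" "\<gamma> s \<in> cdom d" using s T T' by auto
    then show ?thesis
      using tangent_spaceD(1)[OF field_derivative(1)[OF A W I(1) \<open>s \<in> I\<close> c(1)] c(1,2)]
      by (simp add: F_def)
  qed
  have "((\<lambda>s. W s d) has_vector_derivative F' (?u, ?w')) (at t)"
    by (rule has_vector_derivative_transform_within_open[OF dF open_Int[OF T(1) T'(1)] _ Fd]) (use T(2) T'(2) in auto)
  then have w'd: "vector_derivative (\<lambda>s. W s d) (at t) = F' (?u, 0) + ?J ?w'"
    using sum by (simp add: vector_derivative_at)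
  have ud: "velocity A \<gamma> t d = ?J ?u"
    by (rule tangent_spaceD(1)[OF velocity_in_tangent_space[OF A \<gamma> I] c])
  have wd: "W t d = ?J ?w"
    by (rule tangent_spaceD(1)[OF fc(1) c])
  \<comment> \<open>The last summand is the same second-derivative term that appeared in the
    derivative of \<open>W s d\<close>.\<close>
  have "?J (\<Gamma> c (\<gamma> t) ?u ?w) = \<Gamma> d (\<gamma> t) (?J ?u) (?J ?w) +
      frechet_derivative (\<lambda>y. F (y, ?w)) (at ?x) ?u"
    using conn c unfolding affine_connection_def Let_def F_def by auto
  moreover have "frechet_derivative (\<lambda>y. F (y, ?w)) (at ?x) ?u = F' (?u, 0)"
    using frechet_derivative_at[OF 1] by metis
  ultimately have "F' (?u, 0) + \<Gamma> d (\<gamma> t) (?J ?u) (?J ?w) = ?J (\<Gamma> c (\<gamma> t) ?u ?w)" by simp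
  then show "covd A \<Gamma> \<gamma> W t d = ?J (covd A \<Gamma> \<gamma> W t c)"
    using c w'd ud wd linear_add[OF jac_linear[OF A c]] by (simp add: covd_def algebra_simps)
qed

lemma covd_tscale:
  assumes A: "smooth_atlas A" and conn: "affine_connection A \<Gamma>"
    and W: "smooth_map flat_atlas (tangent_atlas A) I (\<lambda>s. (\<gamma> s, W s))"
    and I: "open I" "t \<in> I" and \<phi>: "(\<phi> has_real_derivative \<phi>') (at t)"
  shows "covd A \<Gamma> \<gamma> (\<lambda>s. tscale (\<phi> s) (W s)) t = (\<lambda>c. \<phi> t *\<^sub>R covd A \<Gamma> \<gamma> W t c + \<phi>' *\<^sub>R W t c)"
proof
  fix c
  show "covd A \<Gamma> \<gamma> (\<lambda>s. tscale (\<phi> s) (W s)) t c = \<phi> t *\<^sub>R covd A \<Gamma> \<gamma> W t c + \<phi>' *\<^sub>R W t c"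
  proof (cases "c \<in> A \<and> \<gamma> t \<in> cdom c")
    case True
    then have c: "c \<in> A" "\<gamma> t \<in> cdom c" by auto
    have "bilinear (\<Gamma> c (\<gamma> t))" using conn c by (simp add: affine_connection_def)
    moreover have "vector_derivative (\<lambda>s. \<phi> s *\<^sub>R W s c) (at t) =
        \<phi> t *\<^sub>R vector_derivative (\<lambda>s. W s c) (at t) + \<phi>' *\<^sub>R W t c"
      by (intro vector_derivative_at has_vector_derivative_scaleR \<phi> field_derivative(3)[OF A W I c])
    ultimately show ?thesis
      using True by (simp add: covd_def bilinear_rmul algebra_simps)
  next
    case False
    \<comment> \<open>In an irrelevant chart the extra term has to vanish too; it does, because
      \<open>W t\<close> is a tangent vector and has component 0 there.\<close>
    obtain T where "T \<in> tangent_atlas A" "(\<gamma> t, W t) \<in> cdom T" by (rule smooth_mapE[OF W I(2)])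
    then have "W t \<in> tangent_space A (\<gamma> t)" by (auto simp: tangent_atlas_eq)
    from tangent_spaceD(2)[OF this, of c] have "W t c = 0" using False by simp
    then show ?thesis using False by (auto simp: covd_def)
  qed
qed

text \<open>The Lorentzian condition speaks of \<open>g p\<close> only through
  \<open>tvec_of\<close>. Linearity is thus obtained in a chart, for vectors that are recovered from
  their components.\<close>

lemma metric_add_scale:
  assumes A: "smooth_atlas A" and g: "lorentzian_metric A g" and c: "c \<in> A" "p \<in> cdom c"
    and v: "v \<in> tangent_space A p" and w: "w \<in> tangent_space A p" and y: "y \<in> tangent_space A p"
  shows "g p (\<lambda>c. a *\<^sub>R v c + b *\<^sub>R w c) y = a * g p v y + b * g p w y"
proof -
  have "bilinear (metric_in A g c p)"
    using lorentzian_metric_form[OF g c] by (simp add: lorentz_form_def)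
  moreover have "(\<lambda>c. a *\<^sub>R v c + b *\<^sub>R w c) \<in> tangent_space A p"
    using add_in_tangent_space[OF A tscale_in_tangent_space[OF A v] tscale_in_tangent_space[OF A w]] .
  ultimately show ?thesis
    using metric_in_component[OF c _ y, of _ g] v w
    by (simp add: bilinear_ladd bilinear_lmul)
qed

text \<open>The differential of \<open>f\<close> appears as the derivative \<open>l\<close> of a
  local extension in the chart \<open>d\<close>. It is one linear form on the whole model space,
  chosen before \<open>X\<close> and \<open>Y\<close>, so its kernel can be counted by
  dimension.\<close>

lemma null_second_form_tscale:
  assumes A: "smooth_atlas A" and conn: "affine_connection A \<Gamma>" and g: "lorentzian_metric A g"
    and W: "smooth_map A (tangent_atlas A) N (\<lambda>x. (x, W x))" and f: "smooth_fun A N f"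
    and x: "x \<in> N" "d \<in> A" "x \<in> cdom d"
  obtains l where "linear l"
    "\<forall>X\<in>sub_tangent A N x. \<forall>Y\<in>sub_tangent A N x.
      null_second_form A g \<Gamma> N (\<lambda>x. tscale (f x) (W x)) x X Y =
        f x * null_second_form A g \<Gamma> N W x X Y - l (X d) * g x (W x) Y"
proof -
  have "flat_chart \<in> flat_atlas" "f x \<in> cdom flat_chart" by (simp_all add: flat_atlas_def)
  then obtain D G where D: "coord d x \<in> D" and rep: "local_rep N f d flat_chart D G"
    using smooth_map_in_charts[OF A smooth_atlas_flat f[unfolded smooth_fun_def real_atlas_eq] x(1,2) _ x(3)]
    by blast
  let ?l = "frechet_derivative G (at (coord d x))"
  have lin: "linear ?l" by (rule smooth_on_linear[OF local_repD(2)[OF rep] D])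
  show thesis
  proof (rule that[OF lin], intro ballI)
    fix X Y assume X: "X \<in> sub_tangent A N x" and Y: "Y \<in> sub_tangent A N x"
    \<comment> \<open>The field is absent from this choice: unfolding \<open>dir_covd\<close> for
      \<open>W\<close> and for its rescaling yields the same curve.\<close>
    define \<gamma> where "\<gamma> = (SOME \<gamma>. curve_in A N x X \<gamma>)"
    have "curve_in A N x X \<gamma>"
      using X someI_ex[of "curve_in A N x X"] by (simp add: \<gamma>_def sub_tangent_def)
    then obtain \<epsilon> where e: "\<epsilon> > 0" and \<gamma>: "smooth_map flat_atlas A {-\<epsilon><..<\<epsilon>} \<gamma>" "\<gamma> ` {-\<epsilon><..<\<epsilon>} \<subseteq> N"
      "\<gamma> 0 = x" "velocity A \<gamma> 0 = X"
      unfolding curve_in_def real_atlas_eq by blast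
    have I: "open {-\<epsilon><..<\<epsilon>}" "0 \<in> {-\<epsilon><..<\<epsilon>}" using e by auto
    have d: "d \<in> A" "\<gamma> 0 \<in> cdom d" using x \<gamma>(3) by auto
    have W\<gamma>: "smooth_map flat_atlas (tangent_atlas A) {-\<epsilon><..<\<epsilon>} (\<lambda>s. (\<gamma> s, (W \<circ> \<gamma>) s))"
      using smooth_map_compose[OF smooth_atlas_flat A smooth_atlas_tangent[OF A] \<gamma>(1) W \<gamma>(2)] by simp
    obtain T where T: "open T" "0 \<in> T" "T \<subseteq> {-\<epsilon><..<\<epsilon>}" "\<gamma> ` T \<subseteq> cdom d" "smooth_on T (\<lambda>s. coord d (\<gamma> s))"
      by (rule smooth_map_flat_open[OF A \<gamma>(1) I d])
    have "(G has_derivative ?l) (at (coord d (\<gamma> 0)))"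
      using smooth_onD(1)[OF local_repD(2)[OF rep] D] \<gamma>(3) by simp
    from has_derivative_compose[OF curve_derivative[OF A \<gamma>(1) I d, unfolded has_vector_derivative_def] this]
    have "((\<lambda>s. G (coord d (\<gamma> s))) has_derivative (\<lambda>r. ?l (r *\<^sub>R X d))) (at 0)"
      using \<gamma>(4) by simp
    then have "((\<lambda>s. G (coord d (\<gamma> s))) has_real_derivative ?l (X d)) (at 0)"
      using linear_scale[OF lin] by (simp add: has_field_derivative_def mult_commute_abs)
    then have \<phi>: "((\<lambda>s. f (\<gamma> s)) has_real_derivative ?l (X d)) (at 0)"
    proof (rule has_field_derivative_transform_within_open)
      show "open {s \<in> T. coord d (\<gamma> s) \<in> D}"
        by (rule open_vimage_smooth_on[OF T(5,1) local_repD(1)[OF rep]])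
      show "0 \<in> {s \<in> T. coord d (\<gamma> s) \<in> D}" using T(2) D \<gamma>(3) by simp
      fix s assume "s \<in> {s \<in> T. coord d (\<gamma> s) \<in> D}"
      then show "G (coord d (\<gamma> s)) = f (\<gamma> s)"
        using local_repD(4)[OF rep, of "\<gamma> s"] T(3,4) \<gamma>(2) by (auto simp: image_subset_iff)
    qed
    have "covd A \<Gamma> \<gamma> ((\<lambda>x. tscale (f x) (W x)) \<circ> \<gamma>) 0 =
        (\<lambda>c. f x *\<^sub>R covd A \<Gamma> \<gamma> (W \<circ> \<gamma>) 0 c + ?l (X d) *\<^sub>R W x c)"
      using covd_tscale[OF A conn W\<gamma> I \<phi>] \<gamma>(3) by (simp add: o_def)
    moreover have "W x \<in> tangent_space A x" "covd A \<Gamma> \<gamma> (W \<circ> \<gamma>) 0 \<in> tangent_space A x"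
      using field_derivative(1)[OF A W\<gamma> I d] covd_in_tangent_space[OF A conn \<gamma>(1) W\<gamma> I] \<gamma>(3) by (auto simp: o_def)
    moreover have "Y \<in> tangent_space A x" using Y sub_tangent_subset[OF A] by blast
    ultimately show "null_second_form A g \<Gamma> N (\<lambda>x. tscale (f x) (W x)) x X Y =
        f x * null_second_form A g \<Gamma> N W x X Y - ?l (X d) * g x (W x) Y"
      using metric_add_scale[OF A g x(2,3)]
      by (simp add: null_second_form_def dir_covd_def Let_def flip: \<gamma>_def)
  qed
qed

section \<open>The null hypersurface of the normal exponential map\<close>

locale null_exponential =
  fixes A :: "('m::topological_space, 'e::euclidean_space) chart set"
    and g :: "('m, 'e) metric" and \<Gamma> :: "('m, 'e) conn" and S :: "'m set"
    and \<xi> :: "'m \<Rightarrow> ('m, 'e) tvec" and V :: "('m \<times> ('m, 'e) tvec) set"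
  assumes struct: "smooth_structure A" and lorentzian: "lorentzian_metric A g"
    and normal_field: "lightlike_normal_field A g S \<xi>" and nbhd: "normal_exp_nbhd A g \<Gamma> S V"
begin

abbreviation "TA \<equiv> tangent_atlas A"
abbreviation "D \<equiv> null_domain S \<xi> V"
abbreviation "\<Phi> \<equiv> null_param A \<Gamma> \<xi>"
abbreviation "\<Sigma> \<equiv> \<Phi> ` D"
abbreviation "U \<equiv> push_dt A D \<Phi>"
abbreviation "E \<equiv> exp_map A \<Gamma>"
abbreviation "E_inv \<equiv> inv_into V E"

lemma atlas: "smooth_atlas A"
  by (rule smooth_structure_atlas[OF struct])

lemma tatlas: "smooth_atlas TA"
  by (rule smooth_atlas_tangent[OF atlas])

lemma D_iff: "(p, t) \<in> D \<longleftrightarrow> p \<in> S \<and> (p, tscale t (\<xi> p)) \<in> V"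
  by (simp add: null_domain_def)

lemma null_param_apply: "\<Phi> (p, t) = E (p, tscale t (\<xi> p))"
  by (simp add: null_param_def)

lemma xi_tangent: "p \<in> S \<Longrightarrow> \<xi> p \<in> tangent_space A p"
  using normal_field unfolding lightlike_normal_field_def normal_bundle_def by blast

text \<open>A lightlike vector is nonzero as a family; a single vanishing component would force all
  the others to vanish through the linear Jacobians.\<close>

lemma xi_component_nonzero:
  assumes "p \<in> S" "c \<in> A" "p \<in> cdom c"
  shows "\<xi> p c \<noteq> 0"
proof
  assume 0: "\<xi> p c = 0"
  have "\<xi> p d = 0" for d
  proof (cases "d \<in> A \<and> p \<in> cdom d")
    case True
    then have d: "d \<in> A" "p \<in> cdom d" by auto
    show ?thesis
      using tangent_spaceD(1)[OF xi_tangent[OF assms(1)] assms(2) d(1) assms(3) d(2)] 0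
        linear_0[OF jac_linear[OF atlas assms(2) d(1) assms(3) d(2)]] by simp
  next
    case False
    then show ?thesis using tangent_spaceD(2)[OF xi_tangent[OF assms(1)], of d] by blast
  qed
  then have "\<xi> p = tzero" by (rule ext)
  then show False
    using normal_field assms(1) by (auto simp: lightlike_normal_field_def lightlike_def)
qed

text \<open>\<open>V\<close> is open only relative to the normal bundle, so its openness is usable
  along a ray once the ray is known to stay in that bundle.\<close>

lemma xi_ray_normal:
  assumes p: "p \<in> S"
  shows "(p, tscale r (\<xi> p)) \<in> normal_bundle A g S"
proof -
  obtain c where c: "c \<in> A" "p \<in> cdom c" by (rule smooth_structure_chart[OF struct])
  note xi = xi_tangent[OF p]
  have "g p (tscale r (\<xi> p)) w = 0" if w: "w \<in> sub_tangent A S p" for w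
  proof -
    have "w \<in> tangent_space A p" using w sub_tangent_subset[OF atlas] by blast
    then have "g p (tscale r (\<xi> p)) w = r * g p (\<xi> p) w"
      using metric_add_scale[OF atlas lorentzian c xi xi, of w r 0] by simp
    then show ?thesis
      using normal_field p w by (auto simp: lightlike_normal_field_def normal_bundle_def)
  qed
  then show ?thesis
    using p tscale_in_tangent_space[OF atlas xi] by (simp add: normal_bundle_def)
qed

lemma exp_diffeo:
  obtains N where "bij_betw E V N" "smooth_map TA A V E" "smooth_map A TA N E_inv"
  using nbhd unfolding normal_exp_nbhd_def by blast

lemma exp_smooth: "smooth_map TA A V E"
  using exp_diffeo by blast

lemma exp_inj: "inj_on E V"
  using exp_diffeo bij_betw_imp_inj_on by blast

lemma E_inv_E: "y \<in> V \<Longrightarrow> E_inv (E y) = y"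
  by (rule inv_into_f_f[OF exp_inj])

lemma E_inv_Phi: "(p, t) \<in> D \<Longrightarrow> E_inv (\<Phi> (p, t)) = (p, tscale t (\<xi> p))"
  by (simp add: null_param_apply D_iff E_inv_E)

lemma E_inv_smooth: "smooth_map A TA \<Sigma> E_inv"
proof -
  obtain N where N: "bij_betw E V N" "smooth_map A TA N E_inv" using exp_diffeo by blast
  have "\<Sigma> \<subseteq> N"
  proof clarify
    fix p t assume "(p, t) \<in> D"
    then show "\<Phi> (p, t) \<in> N" using bij_betw_imp_surj_on[OF N(1)] by (auto simp: D_iff null_param_apply)
  qed
  then show ?thesis by (rule smooth_map_subset[OF N(2)])
qed

text \<open>The exponential map is injective on \<open>V\<close>, so the foot point and the multiple
  of \<xi> are determined; the nonzero component of \<xi> then gives the factor.\<close>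

lemma Phi_inj: "inj_on \<Phi> D"
proof (rule inj_onI, clarify)
  fix p t q s assume pt: "(p, t) \<in> D" and qs: "(q, s) \<in> D" and eq: "\<Phi> (p, t) = \<Phi> (q, s)"
  obtain c where c: "c \<in> A" "p \<in> cdom c" by (rule smooth_structure_chart[OF struct])
  have "(p, tscale t (\<xi> p)) = (q, tscale s (\<xi> q))"
    using E_inv_Phi[OF pt] E_inv_Phi[OF qs] eq by metis
  then have q: "q = p" and "tscale t (\<xi> p) = tscale s (\<xi> q)" by blast+
  then have "t *\<^sub>R \<xi> p c = s *\<^sub>R \<xi> p c" using fun_cong[of "tscale t (\<xi> p)" _ c] by simp
  moreover have "\<xi> p c \<noteq> 0" using xi_component_nonzero c pt D_iff by blast
  ultimately show "p = q \<and> t = s" using q by simp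
qed

lemma U_Phi: "(p, t) \<in> D \<Longrightarrow> U (\<Phi> (p, t)) = velocity A (\<lambda>r. \<Phi> (p, r)) t"
  by (simp add: push_dt_def inv_into_f_f[OF Phi_inj])

text \<open>Pulling relative openness back along a smooth family of normal vectors. The parameter
  set \<open>D0\<close> need not be open, so the result is a neighbourhood relative to
  \<open>D0\<close>.\<close>

lemma V_relatively_open:
  fixes z :: "'z::euclidean_space"
  assumes \<beta>: "smooth_map flat_atlas TA D0 \<beta>" "\<beta> ` D0 \<subseteq> normal_bundle A g S" "z \<in> D0" "\<beta> z \<in> V"
  obtains O' where "open O'" "z \<in> O'" "\<forall>y \<in> D0 \<inter> O'. \<beta> y \<in> V"
proof -
  have "rel_open_in_TM A (normal_bundle A g S) V" using nbhd by (simp add: normal_exp_nbhd_def)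
  then obtain T W where T: "T \<in> TA" "\<beta> z \<in> cdom T" "open W" "coord T (\<beta> z) \<in> W"
    and V: "\<forall>y \<in> normal_bundle A g S \<inter> cdom T. coord T y \<in> W \<longrightarrow> y \<in> V"
    using \<beta>(4) unfolding rel_open_in_TM_def by blast
  obtain W' G where z: "z \<in> W'" and rep: "local_rep D0 \<beta> flat_chart T W' G"
    by (rule smooth_map_flat_chart[OF tatlas \<beta>(1,3) T(1,2)])
  note G = local_repD[OF rep]
  show thesis
  proof (rule that[of "{y \<in> W'. G y \<in> W}"])
    show "open {y \<in> W'. G y \<in> W}" by (rule open_vimage_smooth_on[OF G(2,1) T(3)])
    show "z \<in> {y \<in> W'. G y \<in> W}" using z G(4)[of z] \<beta>(3) T(4) by simp
    show "\<forall>y \<in> D0 \<inter> {y \<in> W'. G y \<in> W}. \<beta> y \<in> V"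
    proof
      fix y assume y: "y \<in> D0 \<inter> {y \<in> W'. G y \<in> W}"
      then have "\<beta> y \<in> cdom T" "coord T (\<beta> y) \<in> W" using G(3,4)[of y] by auto
      moreover have "\<beta> y \<in> normal_bundle A g S" using y \<beta>(2) by auto
      ultimately show "\<beta> y \<in> V" using V by auto
    qed
  qed
qed

lemma xi_ray_smooth:
  fixes r :: "'z::euclidean_space \<Rightarrow> real"
  assumes "smooth_map flat_atlas A D0 q" "q ` D0 \<subseteq> S" "smooth_on UNIV r"
  shows "smooth_map flat_atlas TA D0 (\<lambda>z. (q z, tscale (r z) (\<xi> (q z))))"
proof (rule smooth_map_tscale[OF atlas _ assms(3)])
  have "smooth_map A TA S (\<lambda>p. (p, \<xi> p))"
    using normal_field by (simp add: lightlike_normal_field_def)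
  from smooth_map_compose[OF smooth_atlas_flat atlas tatlas assms(1) this assms(2)]
  show "smooth_map flat_atlas TA D0 (\<lambda>z. (q z, \<xi> (q z)))" .
qed

lemma Phi_smooth:
  fixes r :: "'z::euclidean_space \<Rightarrow> real"
  assumes "smooth_map flat_atlas A D0 q" "smooth_on UNIV r" "\<And>z. z \<in> D0 \<Longrightarrow> (q z, r z) \<in> D"
  shows "smooth_map flat_atlas A D0 (\<lambda>z. \<Phi> (q z, r z))"
proof -
  have "q ` D0 \<subseteq> S" using assms(3) D_iff by blast
  note ray = xi_ray_smooth[OF assms(1) this assms(2)]
  have "(\<lambda>z. (q z, tscale (r z) (\<xi> (q z)))) ` D0 \<subseteq> V" using assms(3) D_iff by blast
  from smooth_map_compose[OF smooth_atlas_flat tatlas atlas ray exp_smooth this]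
  show ?thesis by (simp add: null_param_apply)
qed

section \<open>The null rays and the generator \<open>U\<close> along them\<close>

definition ray_dom :: "'m \<Rightarrow> real set" where
  "ray_dom p = {t. (p, t) \<in> D}"

lemma const_smooth: "smooth_map flat_atlas A D0 (\<lambda>z. p)"
  by (rule smooth_structure_chart[OF struct]) (rule smooth_map_const)

text \<open>Two-sided derivatives of a ray at \<open>t\<close> require a neighbourhood of
  \<open>t\<close>; the relative openness of \<open>V\<close> provides it along the line of
  multiples of \<xi>.\<close>

lemma ray_dom_open:
  assumes p: "p \<in> S"
  shows "open (ray_dom p)"
proof (rule Topological_Spaces.openI)
  fix t assume t: "t \<in> ray_dom p"
  have ray: "smooth_map flat_atlas TA UNIV (\<lambda>r. (p, tscale r (\<xi> p)))"
    by (rule xi_ray_smooth[OF const_smooth]) (use p smooth_on_id[of "UNIV :: real set"] in auto)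
  have "(\<lambda>r. (p, tscale r (\<xi> p))) ` UNIV \<subseteq> normal_bundle A g S" "(p, tscale t (\<xi> p)) \<in> V"
    using xi_ray_normal[OF p] t by (auto simp: ray_dom_def D_iff)
  then obtain T where "open T" "t \<in> T" "\<forall>r \<in> UNIV \<inter> T. (p, tscale r (\<xi> p)) \<in> V"
    using V_relatively_open[OF ray _ UNIV_I, of t] by blast
  then show "\<exists>T. open T \<and> t \<in> T \<and> T \<subseteq> ray_dom p" using p by (auto simp: ray_dom_def D_iff)
qed

lemma ray_smooth: "smooth_map flat_atlas A (ray_dom p) (\<lambda>r. \<Phi> (p, r))"
  by (rule Phi_smooth[OF const_smooth smooth_on_id]) (auto simp: ray_dom_def)

lemma ray_derivative:
  assumes "(p, t) \<in> D" "d \<in> A" "\<Phi> (p, t) \<in> cdom d"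
  shows "((\<lambda>r. coord d (\<Phi> (p, r))) has_vector_derivative U (\<Phi> (p, t)) d) (at t)"
  using curve_derivative[OF atlas ray_smooth ray_dom_open _ assms(2), of p t] assms
  by (simp add: U_Phi ray_dom_def D_iff)

lemma U_tangent:
  assumes "(p, t) \<in> D"
  shows "U (\<Phi> (p, t)) \<in> tangent_space A (\<Phi> (p, t))"
  using velocity_in_tangent_space[OF atlas ray_smooth ray_dom_open, of p t] assms
  by (simp add: U_Phi ray_dom_def D_iff)

text \<open>Along a null ray the foot point is fixed and the fibre coordinate moves with velocity
  \<open>\<xi> q c\<close>, so \<open>U\<close> is a fibre derivative of the exponential map. The
  right-hand side contains no curve any more, and smoothness can be read off from it.\<close>

lemma U_in_chart:
  assumes qs: "(q, s) \<in> D" and c: "q \<in> cdom c" and d: "d \<in> A"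
    and rep: "local_rep V E (tchart A c) d W G" and W: "(coord c q, s *\<^sub>R \<xi> q c) \<in> W"
  shows "U (\<Phi> (q, s)) d = frechet_derivative G (at (coord c q, s *\<^sub>R \<xi> q c)) (0, \<xi> q c)"
proof -
  have q: "q \<in> S" using qs D_iff by blast
  let ?b = "\<lambda>r. (coord c q, r *\<^sub>R \<xi> q c)"
  have EG: "\<Phi> (q, r) \<in> cdom d \<and> coord d (\<Phi> (q, r)) = G (?b r)" if "r \<in> ray_dom q" "?b r \<in> W" for r
  proof -
    have "(q, tscale r (\<xi> q)) \<in> V" using that(1) by (simp add: ray_dom_def D_iff)
    then show ?thesis
      using local_repD(3,4)[OF rep, of "(q, tscale r (\<xi> q))"] that(2) c
        tscale_in_tangent_space[OF atlas xi_tangent[OF q]] by (simp add: null_param_apply)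
  qed
  have s: "s \<in> ray_dom q" using qs by (simp add: ray_dom_def)
  have "(?b has_derivative (\<lambda>r. (0, r *\<^sub>R \<xi> q c))) (at s)"
    by (intro has_derivative_Pair) (auto intro!: derivative_eq_intros)
  from has_derivative_compose[OF this smooth_onD(1)[OF local_repD(2)[OF rep] W]]
  have "((\<lambda>r. G (?b r)) has_derivative (\<lambda>r. frechet_derivative G (at (?b s)) (0, r *\<^sub>R \<xi> q c))) (at s)" .
  moreover have "frechet_derivative G (at (?b s)) (0, r *\<^sub>R \<xi> q c) =
      r *\<^sub>R frechet_derivative G (at (?b s)) (0, \<xi> q c)" for r
    using linear_scale[OF smooth_on_linear[OF local_repD(2)[OF rep] W], of r "(0, \<xi> q c)"] by simp
  ultimately have "((\<lambda>r. G (?b r)) has_vector_derivative frechet_derivative G (at (?b s)) (0, \<xi> q c)) (at s)"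
    by (simp add: has_vector_derivative_def)
  then have "((\<lambda>r. coord d (\<Phi> (q, r))) has_vector_derivative
      frechet_derivative G (at (?b s)) (0, \<xi> q c)) (at s)"
  proof (rule has_vector_derivative_transform_within_open)
    have "continuous_on UNIV ?b" by (intro continuous_intros)
    then show "open (ray_dom q \<inter> ?b -` W)"
      using ray_dom_open[OF q] open_vimage[OF local_repD(1)[OF rep]] by blast
    show "s \<in> ray_dom q \<inter> ?b -` W" using s W by simp
    fix r assume "r \<in> ray_dom q \<inter> ?b -` W"
    then show "G (?b r) = coord d (\<Phi> (q, r))" using EG[of r] by simp
  qed
  moreover have "((\<lambda>r. coord d (\<Phi> (q, r))) has_vector_derivative U (\<Phi> (q, s)) d) (at s)"
    using ray_derivative[OF qs d] EG[OF s W] by blast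
  ultimately show ?thesis by (rule vector_derivative_unique_at[symmetric])
qed

lemma Sigma_E_inv:
  assumes "y \<in> \<Sigma>"
  obtains q s where "(q, s) \<in> D" "y = \<Phi> (q, s)" "E_inv y = (q, tscale s (\<xi> q))"
proof -
  from assms obtain q s where "(q, s) \<in> D" "y = \<Phi> (q, s)" by auto
  then show thesis using that E_inv_Phi by blast
qed

lemma U_smooth: "smooth_map A TA \<Sigma> (\<lambda>x. (x, U x))"
proof (rule smooth_mapI)
  fix x assume x: "x \<in> \<Sigma>"
  obtain p t where pt: "(p, t) \<in> D" "x = \<Phi> (p, t)" "E_inv x = (p, tscale t (\<xi> p))" by (rule Sigma_E_inv[OF x])
  have p: "p \<in> S" using pt(1) D_iff by blast
  obtain d where d: "d \<in> A" "x \<in> cdom d" by (rule smooth_structure_chart[OF struct])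
  obtain c where c: "c \<in> A" "p \<in> cdom c" by (rule smooth_structure_chart[OF struct])
  note tc = tchart_in[OF c(1)]
  have E_inv_tangent: "E_inv ` \<Sigma> \<subseteq> {(p, v). v \<in> tangent_space A p}"
  proof
    fix z assume "z \<in> E_inv ` \<Sigma>"
    then obtain y where y: "y \<in> \<Sigma>" "z = E_inv y" by blast
    obtain q s where "(q, s) \<in> D" "E_inv y = (q, tscale s (\<xi> q))" by (rule Sigma_E_inv[OF y(1)])
    then show "z \<in> {(p, v). v \<in> tangent_space A p}"
      using y(2) tscale_in_tangent_space[OF atlas xi_tangent] by (simp add: D_iff)
  qed
  have foot: "smooth_map A A \<Sigma> (\<lambda>y. fst (E_inv y))"
    by (rule smooth_map_compose[OF atlas tatlas atlas E_inv_smooth smooth_map_fst[OF struct] E_inv_tangent])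
  have "smooth_map A TA S (\<lambda>p. (p, \<xi> p))"
    using normal_field by (simp add: lightlike_normal_field_def)
  moreover have "(\<lambda>y. fst (E_inv y)) ` \<Sigma> \<subseteq> S"
    using E_inv_Phi by (auto simp: D_iff)
  \<comment> \<open>\<open>E_inv\<close> returns only the multiple \<open>s\<close> of \<xi>, which
    loses the direction at \<open>s = 0\<close>. The field \<xi> is therefore recovered separately,
    from the foot point.\<close>
  ultimately have xi_foot: "smooth_map A TA \<Sigma> (\<lambda>y. (fst (E_inv y), \<xi> (fst (E_inv y))))"
    using smooth_map_compose[OF atlas atlas tatlas foot] by blast
  have "E_inv x \<in> cdom (tchart A c)"
    using pt(3) c(2) tscale_in_tangent_space[OF atlas xi_tangent[OF p]] by simp
  then obtain W1 H1 where x1: "coord d x \<in> W1" and rep1: "local_rep \<Sigma> E_inv d (tchart A c) W1 H1"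
    by (rule smooth_map_in_charts[OF atlas tatlas E_inv_smooth x d(1) tc d(2)])
  have "(fst (E_inv x), \<xi> (fst (E_inv x))) \<in> cdom (tchart A c)"
    using pt(3) c(2) xi_tangent[OF p] by simp
  then obtain W2 H2 where x2: "coord d x \<in> W2"
    and rep2: "local_rep \<Sigma> (\<lambda>y. (fst (E_inv y), \<xi> (fst (E_inv y)))) d (tchart A c) W2 H2"
    by (rule smooth_map_in_charts[OF atlas tatlas xi_foot x d(1) tc d(2)])
  have "E (p, tscale t (\<xi> p)) \<in> cdom d" "(p, tscale t (\<xi> p)) \<in> V" "(p, tscale t (\<xi> p)) \<in> cdom (tchart A c)"
    using pt d(2) \<open>E_inv x \<in> cdom (tchart A c)\<close> by (auto simp: null_param_apply D_iff)
  then obtain W3 G where x3: "coord (tchart A c) (p, tscale t (\<xi> p)) \<in> W3"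
    and rep3: "local_rep V E (tchart A c) d W3 G"
    using smooth_map_in_charts[OF tatlas atlas exp_smooth _ tc d(1)] by blast
  note r1 = local_repD[OF rep1] and r2 = local_repD[OF rep2] and r3 = local_repD[OF rep3]
  define W where "W = {z \<in> W1. H1 z \<in> W3} \<inter> W2"
  define K where "K = (\<lambda>z. (z, frechet_derivative G (at (H1 z)) (0, snd (H2 z))))"
  have W: "open W" unfolding W_def by (intro open_Int r2(1) open_vimage_smooth_on[OF r1(2,1) r3(1)])
  have "smooth_on W (\<lambda>z. frechet_derivative G (at (H1 z)) (0, snd (H2 z)))"
    by (intro smooth_on_derivative_apply[OF W r3(2)] smooth_on_Pair[OF W] smooth_on_const
        smooth_on_snd[OF W] smooth_on_subset[OF r1(2)] smooth_on_subset[OF r2(2)]) (auto simp: W_def)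
  then have K: "smooth_on W K" unfolding K_def by (intro smooth_on_Pair[OF W smooth_on_id[OF W]])
  have "local_rep \<Sigma> (\<lambda>x. (x, U x)) d (tchart A d) W K"
    unfolding local_rep_def
  proof (intro conjI ballI impI W K)
    fix y assume "y \<in> \<Sigma> \<inter> cdom d" and yW: "coord d y \<in> W"
    then have y: "y \<in> \<Sigma>" "y \<in> cdom d" by auto
    obtain q s where qs: "(q, s) \<in> D" "y = \<Phi> (q, s)" "E_inv y = (q, tscale s (\<xi> q))"
      by (rule Sigma_E_inv[OF y(1)])
    have w: "coord d y \<in> W1" "H1 (coord d y) \<in> W3" "coord d y \<in> W2" using yW by (auto simp: W_def)
    have q: "q \<in> cdom c" using r1(3)[OF y w(1)] qs(3) by simp
    have H: "H1 (coord d y) = (coord c q, s *\<^sub>R \<xi> q c)" "snd (H2 (coord d y)) = \<xi> q c"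
      using r1(4)[OF y w(1)] r2(4)[OF y w(3)] qs(3) by (auto simp flip: r2(4)[OF y w(3)])
    show "(y, U y) \<in> cdom (tchart A d)" using y(2) U_tangent[OF qs(1)] qs(2) by simp
    show "coord (tchart A d) (y, U y) = K (coord d y)"
      using U_in_chart[OF qs(1) q d(1) rep3] w(2) H qs(2) by (simp add: K_def)
  qed
  moreover have "coord d x \<in> W"
    using x1 x2 x3 r1(4)[OF x d(2) x1] pt(3) by (simp add: W_def)
  ultimately show "\<exists>c\<in>A. \<exists>d\<in>TA. x \<in> cdom c \<and>
      (\<exists>W G. coord c x \<in> W \<and> local_rep \<Sigma> (\<lambda>x. (x, U x)) c d W G)"
    using d tchart_in[OF d(1)] by blast
qed

lemma velocity_zero_E_inv:
  assumes \<alpha>: "smooth_map flat_atlas A I \<alpha>" "open I" "t \<in> I" "\<alpha> ` I \<subseteq> \<Sigma>"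
    and d: "d \<in> A" "\<alpha> t \<in> cdom d" "velocity A \<alpha> t d = 0"
    and c: "c \<in> A" "E_inv (\<alpha> t) \<in> cdom (tchart A c)"
  shows "((\<lambda>s. coord (tchart A c) (E_inv (\<alpha> s))) has_vector_derivative 0) (at t)"
  by (rule smooth_map_curve_zero[OF atlas tatlas E_inv_smooth \<alpha> d tchart_in[OF c(1)] c(2)])

text \<open>\<open>E_inv\<close> carries the ray back to the line of multiples of \<xi>, whose
  velocity \<open>(0, \<xi> p c)\<close> is nonzero; a vanishing velocity of the ray would make it
  zero.\<close>

lemma U_component_nonzero:
  assumes pt: "(p, t) \<in> D" and d: "d \<in> A" "\<Phi> (p, t) \<in> cdom d"
  shows "U (\<Phi> (p, t)) d \<noteq> 0"
proof
  assume 0: "U (\<Phi> (p, t)) d = 0"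
  have p: "p \<in> S" and t: "t \<in> ray_dom p" using pt by (simp_all add: D_iff ray_dom_def)
  obtain c where c: "c \<in> A" "p \<in> cdom c" by (rule smooth_structure_chart[OF struct])
  have v: "velocity A (\<lambda>r. \<Phi> (p, r)) t d = 0" using 0 U_Phi[OF pt] by simp
  have "(\<lambda>r. \<Phi> (p, r)) ` ray_dom p \<subseteq> \<Sigma>" by (auto simp: ray_dom_def)
  moreover have "E_inv (\<Phi> (p, t)) \<in> cdom (tchart A c)"
    using c tscale_in_tangent_space[OF atlas xi_tangent[OF p]] by (simp add: E_inv_Phi[OF pt])
  ultimately have "((\<lambda>s. coord (tchart A c) (E_inv (\<Phi> (p, s)))) has_vector_derivative 0) (at t)"
    by (intro velocity_zero_E_inv[OF ray_smooth ray_dom_open[OF p] t _ d v c(1)])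
  then have "((\<lambda>s. (coord c p, s *\<^sub>R \<xi> p c)) has_vector_derivative 0) (at t)"
    by (rule has_vector_derivative_transform_within_open[OF _ ray_dom_open[OF p] t])
      (simp add: ray_dom_def E_inv_Phi)
  moreover have "((\<lambda>s. (coord c p, s *\<^sub>R \<xi> p c)) has_vector_derivative (0, \<xi> p c)) (at t)"
    by (intro has_vector_derivative_Pair) (auto intro!: derivative_eq_intros)
  ultimately have "(0, \<xi> p c) = (0 :: 'e \<times> 'e)" using vector_derivative_unique_at by metis
  then show False using xi_component_nonzero[OF p c] by (simp add: zero_prod_def)
qed

end

section \<open>Size of the tangent space of the hypersurface\<close>

context null_exponential
begin

text \<open>The curves \<open>s \<mapsto> \<Phi> (p\<^sub>s, t + s a)\<close>, with \<open>p\<^sub>s\<close> a straight line in a submanifold chart of \<open>S\<close>,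
  realize a linear image of \<open>\<real> \<times> L\<close>; the smooth inverse of the exponential map makes it injective.\<close>

lemma sub_tangent_Sigma_large:
  assumes emb: "embedded_submanifold A n S" and x: "x \<in> \<Sigma>" and d: "d \<in> A" "x \<in> cdom d"
  obtains Q where "subspace Q" "dim Q = n + 1" "\<forall>u\<in>Q. \<exists>X\<in>sub_tangent A \<Sigma> x. X d = u"
proof -
  obtain p t where pt: "(p, t) \<in> D" "x = \<Phi> (p, t)" "E_inv x = (p, tscale t (\<xi> p))" by (rule Sigma_E_inv[OF x])
  have p: "p \<in> S" using pt(1) D_iff by blast
  obtain c L where c: "c \<in> A" "p \<in> cdom c" and L: "subspace L" "dim L = n"
    and slice: "coord c ` (cdom c \<inter> S) = coord c ` cdom c \<inter> L"
    using emb p unfolding embedded_submanifold_def by blast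
  let ?X = "coord c ` cdom c"
  have X: "open ?X" using smooth_atlasD(2)[OF atlas c(1) c(1)] by simp
  define q where "q = (\<lambda>z :: real \<times> 'e. cinv c (coord c p + snd z))"
  define r where "r = (\<lambda>z :: real \<times> 'e. t + fst z)"
  \<comment> \<open>Displacements in \<open>L\<close> keep the foot point in \<open>S\<close>, since
    \<open>L\<close> is a linear subspace containing \<open>coord c p\<close>. The second factor of
    the parameter space is all of \<open>'e\<close>, so \<open>D1\<close> is in general not
    open.\<close>
  define D1 where "D1 = {z :: real \<times> 'e. snd z \<in> L \<and> coord c p + snd z \<in> ?X}"
  have pL: "coord c p \<in> L" using slice c(2) p by blast
  have q: "q z \<in> cdom c" "q z \<in> S" "coord c (q z) = coord c p + snd z" if "z \<in> D1" for z
  proof -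
    have "coord c p + snd z \<in> ?X \<inter> L" using that pL L(1) by (auto simp: D1_def subspace_add)
    then obtain y where "y \<in> cdom c" "y \<in> S" "coord c p + snd z = coord c y" using slice by blast
    then show "q z \<in> cdom c" "q z \<in> S" "coord c (q z) = coord c p + snd z"
      using cinv_coord[OF atlas c(1)] by (simp_all add: q_def)
  qed
  have id: "smooth_on UNIV (\<lambda>z :: real \<times> 'e. z)" by (rule smooth_on_id[OF open_UNIV])
  have "local_rep D1 q flat_chart c UNIV (\<lambda>z. coord c p + snd z)"
    using q smooth_on_add[OF open_UNIV smooth_on_const smooth_on_snd[OF open_UNIV id]]
    by (simp add: local_rep_def)
  then have q_smooth: "smooth_map flat_atlas A D1 q"
    using c(1) by (intro smooth_map_flatI) blast
  have r_smooth: "smooth_on UNIV r"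
    unfolding r_def by (rule smooth_on_add[OF open_UNIV smooth_on_const smooth_on_fst[OF open_UNIV id]])
  have z0: "0 \<in> D1" using c(2) L(1) by (auto simp: D1_def subspace_0)
  have q0: "q 0 = p" "r 0 = t" using cinv_coord[OF atlas c] by (simp_all add: q_def r_def)
  have qS: "q ` D1 \<subseteq> S" using q(2) by blast
  have "(\<lambda>z. (q z, tscale (r z) (\<xi> (q z)))) ` D1 \<subseteq> normal_bundle A g S"
    using xi_ray_normal q(2) by blast
  moreover have "(q 0, tscale (r 0) (\<xi> (q 0))) \<in> V" using pt(1) q0 by (simp add: D_iff)
  ultimately obtain O' where O': "open O'" "0 \<in> O'" "\<forall>z \<in> D1 \<inter> O'. (q z, tscale (r z) (\<xi> (q z))) \<in> V"
    by (rule V_relatively_open[OF xi_ray_smooth[OF q_smooth qS r_smooth] _ z0])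
  define D0 where "D0 = D1 \<inter> O'"
  have qrD: "(q z, r z) \<in> D" if "z \<in> D0" for z using that O'(3) q(2) by (simp add: D0_def D_iff)
  define \<psi> where "\<psi> = (\<lambda>z. \<Phi> (q z, r z))"
  have \<psi>_Sigma: "\<psi> z \<in> \<Sigma>" if "z \<in> D0" for z
    unfolding \<psi>_def by (rule imageI[OF qrD[OF that]])
  have \<psi>_smooth: "smooth_map flat_atlas A D0 \<psi>"
    unfolding \<psi>_def
    by (rule Phi_smooth[OF smooth_map_subset[OF q_smooth] r_smooth qrD]) (auto simp: D0_def)
  have \<psi>0: "\<psi> 0 = x" using q0 pt(2) by (simp add: \<psi>_def)
  have z0': "0 \<in> D0" using z0 O'(2) by (simp add: D0_def)
  obtain W G where W: "0 \<in> W" and rep: "local_rep D0 \<psi> flat_chart d W G"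
    by (rule smooth_map_flat_chart[OF atlas \<psi>_smooth z0' d(1)]) (use d(2) \<psi>0 in auto)
  \<comment> \<open>\<open>K\<close> is meaningful on \<open>real \<times> L\<close>, the directions
    tangent to the parameter domain; elsewhere it reflects the extension \<open>G\<close>.\<close>
  define K where "K = frechet_derivative G (at 0)"
  have G: "(G has_derivative K) (at 0)"
    unfolding K_def by (rule smooth_onD(1)[OF local_repD(2)[OF rep] W])
  have lin: "linear K" using G has_derivative_linear by blast
  define Y where "Y = O' \<inter> W \<inter> {z :: real \<times> 'e. coord c p + snd z \<in> ?X}"
  have Y: "open Y" "0 \<in> Y"
  proof -
    have "open ((\<lambda>z :: real \<times> 'e. coord c p + snd z) -` ?X)"
      by (intro open_vimage[OF X] continuous_intros)
    then show "open Y" using O'(1) local_repD(1)[OF rep] by (simp add: Y_def vimage_def open_Int)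
    show "0 \<in> Y" using O'(2) W c(2) by (simp add: Y_def)
  qed
  have curve: "\<exists>\<epsilon>>0. smooth_map flat_atlas A {-\<epsilon><..<\<epsilon>} (\<lambda>s. \<psi> (s *\<^sub>R z)) \<and>
      (\<forall>s\<in>{-\<epsilon><..<\<epsilon>}. s *\<^sub>R z \<in> D0) \<and> velocity A (\<lambda>s. \<psi> (s *\<^sub>R z)) 0 d = K z" if z: "snd z \<in> L" for z
  proof -
    have "open ((\<lambda>s::real. s *\<^sub>R z) -` Y)" by (intro open_vimage[OF Y(1)] continuous_intros)
    moreover have "0 \<in> (\<lambda>s::real. s *\<^sub>R z) -` Y" using Y(2) by simp
    ultimately obtain \<epsilon> where e: "\<epsilon> > 0" "ball 0 \<epsilon> \<subseteq> (\<lambda>s::real. s *\<^sub>R z) -` Y"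
      by (metis open_contains_ball)
    let ?I = "{-\<epsilon><..<\<epsilon>}"
    have I: "s *\<^sub>R z \<in> D0 \<and> s *\<^sub>R z \<in> W" if "s \<in> ?I" for s
    proof -
      have "s *\<^sub>R z \<in> Y" using e(2) that by (auto simp: subset_iff dist_real_def)
      then show ?thesis using L(1) z by (auto simp: Y_def D0_def D1_def subspace_scale)
    qed
    have "smooth_map flat_atlas flat_atlas ?I (\<lambda>s. s *\<^sub>R z)"
      by (rule smooth_map_flat_flat[OF open_UNIV smooth_on_scaleR[OF open_UNIV smooth_on_id smooth_on_const]]) auto
    then have \<alpha>: "smooth_map flat_atlas A ?I (\<lambda>s. \<psi> (s *\<^sub>R z))"
      by (rule smooth_map_compose[OF smooth_atlas_flat smooth_atlas_flat atlas _ \<psi>_smooth]) (use I in auto)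
    have 0: "open ?I" "0 \<in> ?I" "\<psi> (0 *\<^sub>R z) \<in> cdom d" using e(1) \<psi>0 d(2) by auto
    have "((\<lambda>s. s *\<^sub>R z) has_derivative (\<lambda>s. s *\<^sub>R z)) (at (0::real))"
      by (auto intro!: derivative_eq_intros)
    from has_derivative_compose[OF this, of G K] G
    have "((\<lambda>s. G (s *\<^sub>R z)) has_vector_derivative K z) (at 0)"
      using linear_scale[OF lin] by (simp add: has_vector_derivative_def)
    then have "((\<lambda>s. coord d (\<psi> (s *\<^sub>R z))) has_vector_derivative K z) (at 0)"
      by (rule has_vector_derivative_transform_within_open[OF _ 0(1,2)])
        (use I local_repD(4)[OF rep] in simp)
    then have "velocity A (\<lambda>s. \<psi> (s *\<^sub>R z)) 0 d = K z"
      using vector_derivative_unique_at[OF curve_derivative[OF atlas \<alpha> 0(1,2) d(1) 0(3)]] by blast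
    then show ?thesis using e(1) \<alpha> I by blast
  qed
  let ?P = "(UNIV :: real set) \<times> L"
  have sub: "subspace ?P" by (intro subspace_Times subspace_UNIV L(1))
  have "inj_on K ?P"
    unfolding linear_inj_on_iff_eq_0[OF lin sub]
  proof (intro ballI impI)
    fix z assume z: "z \<in> ?P" and Kz: "K z = 0"
    obtain a w where aw: "z = (a, w)" "w \<in> L" using z by auto
    obtain \<epsilon> where e: "\<epsilon> > 0" and \<alpha>: "smooth_map flat_atlas A {-\<epsilon><..<\<epsilon>} (\<lambda>s. \<psi> (s *\<^sub>R z))"
      and D0: "\<And>s. s \<in> {-\<epsilon><..<\<epsilon>} \<Longrightarrow> s *\<^sub>R z \<in> D0"
      and v: "velocity A (\<lambda>s. \<psi> (s *\<^sub>R z)) 0 d = 0"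
      using curve[of z] Kz aw by auto
    have I: "open {-\<epsilon><..<\<epsilon>}" "0 \<in> {-\<epsilon><..<\<epsilon>}" using e by auto
    have im: "(\<lambda>s. \<psi> (s *\<^sub>R z)) ` {-\<epsilon><..<\<epsilon>} \<subseteq> \<Sigma>"
      using D0 \<psi>_Sigma by (simp add: image_subset_iff)
    have d0: "\<psi> (0 *\<^sub>R z) \<in> cdom d" using \<psi>0 d(2) by simp
    have c0: "E_inv (\<psi> (0 *\<^sub>R z)) \<in> cdom (tchart A c)"
      using \<psi>0 pt(3) c(2) tscale_in_tangent_space[OF atlas xi_tangent[OF p]] by simp
    \<comment> \<open>After \<open>E_inv\<close> the curve splits into its foot point and a multiple
      of \<xi>; both must have zero velocity.\<close>
    note zero = velocity_zero_E_inv[OF \<alpha> I im d(1) d0 v c(1) c0]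
    have E: "E_inv (\<psi> (s *\<^sub>R z)) = (q (s *\<^sub>R z), tscale (t + s * a) (\<xi> (q (s *\<^sub>R z))))"
      and qz: "coord c (q (s *\<^sub>R z)) = coord c p + s *\<^sub>R w" if "s \<in> {-\<epsilon><..<\<epsilon>}" for s
      using E_inv_Phi[OF qrD[OF D0[OF that]]] q(3)[of "s *\<^sub>R z"] D0[OF that] aw
      by (simp_all add: \<psi>_def r_def D0_def)
    have "((\<lambda>s. (coord c p + s *\<^sub>R w, (t + s * a) *\<^sub>R \<xi> (q (s *\<^sub>R z)) c)) has_vector_derivative 0) (at 0)"
      by (rule has_vector_derivative_transform_within_open[OF zero I]) (simp add: E qz)
    then have 1: "((\<lambda>s. coord c p + s *\<^sub>R w) has_vector_derivative 0) (at 0)"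
      and 2: "((\<lambda>s. (t + s * a) *\<^sub>R \<xi> (q (s *\<^sub>R z)) c) has_vector_derivative 0) (at 0)"
      using bounded_linear.has_vector_derivative[OF bounded_linear_fst]
        bounded_linear.has_vector_derivative[OF bounded_linear_snd] by fastforce+
    have "((\<lambda>s. coord c p + s *\<^sub>R w) has_vector_derivative w) (at 0)"
      by (auto intro!: derivative_eq_intros)
    with 1 have w: "w = 0" using vector_derivative_unique_at by blast
    \<comment> \<open>With \<open>w = 0\<close> the foot point no longer moves, and the fibre
      component isolates \<open>a\<close>.\<close>
    have "q (s *\<^sub>R z) = p" for s using cinv_coord[OF atlas c] by (simp add: q_def aw w)
    with 2 have "((\<lambda>s. (t + s * a) *\<^sub>R \<xi> p c) has_vector_derivative 0) (at 0)" by simp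
    moreover have "((\<lambda>s. (t + s * a) *\<^sub>R \<xi> p c) has_vector_derivative a *\<^sub>R \<xi> p c) (at 0)"
      by (auto intro!: derivative_eq_intros)
    ultimately have "a *\<^sub>R \<xi> p c = 0" using vector_derivative_unique_at by blast
    then show "z = 0" using xi_component_nonzero[OF p c] aw w by (simp add: zero_prod_def)
  qed
  then have "dim (K ` ?P) = dim ?P"
    by (intro dim_image_eq[OF lin]) (simp add: span_eq_iff[THEN iffD2, OF sub])
  also have "\<dots> = n + 1" using dim_Times[OF subspace_UNIV[where 'a = real] L(1)] L(2) by simp
  finally have "dim (K ` ?P) = n + 1" .
  moreover have "\<exists>X\<in>sub_tangent A \<Sigma> x. X d = u" if u: "u \<in> K ` ?P" for u
  proof -
    obtain z where "z \<in> ?P" "u = K z" using u by (rule imageE)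
    then have z: "snd z \<in> L" "u = K z" by auto
    obtain \<epsilon> where e: "\<epsilon> > 0" "smooth_map flat_atlas A {-\<epsilon><..<\<epsilon>} (\<lambda>s. \<psi> (s *\<^sub>R z))"
      "\<forall>s\<in>{-\<epsilon><..<\<epsilon>}. s *\<^sub>R z \<in> D0" "velocity A (\<lambda>s. \<psi> (s *\<^sub>R z)) 0 d = u"
      using curve[OF z(1)] z(2) by blast
    have "(\<lambda>s. \<psi> (s *\<^sub>R z)) ` {-\<epsilon><..<\<epsilon>} \<subseteq> \<Sigma>" using e(3) \<psi>_Sigma by (simp add: image_subset_iff)
    then have "curve_in A \<Sigma> x (velocity A (\<lambda>s. \<psi> (s *\<^sub>R z)) 0) (\<lambda>s. \<psi> (s *\<^sub>R z))"
      using e(1,2) \<psi>0 by (auto simp: curve_in_def real_atlas_eq)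
    then show ?thesis using e(4) by (auto simp: sub_tangent_def)
  qed
  ultimately show thesis
    using that[of "K ` ?P"] linear_subspace_image[OF lin sub] by blast
qed

section \<open>Effect of the rescaling on the umbilical factor and on the parameter of a ray\<close>

lemma umbilical_factor_tscale:
  assumes emb: "embedded_submanifold A n S" and n: "n \<ge> 2" and conn: "affine_connection A \<Gamma>"
    and f: "smooth_fun A \<Sigma> f" and mu: "umbilical_factor A g \<Gamma> \<Sigma> U \<mu>"
    and mu': "umbilical_factor A g \<Gamma> \<Sigma> (\<lambda>x. tscale (f x) (U x)) \<mu>'"
    and x: "x \<in> \<Sigma>"
  shows "\<mu>' x = f x * \<mu> x"
proof (rule ccontr)
  assume "\<mu>' x \<noteq> f x * \<mu> x"
  then have ne: "\<mu>' x - f x * \<mu> x \<noteq> 0" by simp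
  obtain d where d: "d \<in> A" "x \<in> cdom d" by (rule smooth_structure_chart[OF struct])
  let ?T = "sub_tangent A \<Sigma> x" and ?B = "metric_in A g d x"
  obtain l where l: "linear l"
    and nsf: "\<forall>X\<in>?T. \<forall>Y\<in>?T.
      null_second_form A g \<Gamma> \<Sigma> (\<lambda>x. tscale (f x) (U x)) x X Y =
        f x * null_second_form A g \<Gamma> \<Sigma> U x X Y - l (X d) * g x (U x) Y"
    by (rule null_second_form_tscale[OF atlas conn lorentzian U_smooth f x d])
  have key: "(\<mu>' x - f x * \<mu> x) * g x X Y = - l (X d) * g x (U x) Y" if "X \<in> ?T" "Y \<in> ?T" for X Y
  proof -
    have "null_second_form A g \<Gamma> \<Sigma> U x X Y = \<mu> x * g x X Y"
      and "null_second_form A g \<Gamma> \<Sigma> (\<lambda>x. tscale (f x) (U x)) x X Y = \<mu>' x * g x X Y"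
      using mu mu' x that unfolding umbilical_factor_def by blast+
    moreover note nsf[rule_format, OF that]
    ultimately show ?thesis by (simp add: algebra_simps)
  qed
  obtain Q where Q: "subspace Q" "dim Q = n + 1" "\<forall>u\<in>Q. \<exists>X\<in>?T. X d = u"
    by (rule sub_tangent_Sigma_large[OF emb x d])
  let ?H = "{u. l u = 0}"
  \<comment> \<open>The Leibniz term contains \<open>l\<close> of the first argument only, so a
    kernel vector is orthogonal to all of \<open>Q\<close>.\<close>
  have iso: "?B u v = 0" if u: "u \<in> Q" "l u = 0" and v: "v \<in> Q" for u v
  proof -
    obtain X Y where XY: "X \<in> ?T" "X d = u" "Y \<in> ?T" "Y d = v" using Q(3) u(1) v by blast
    then have "g x X Y = 0" using key[OF XY(1,3)] u(2) ne by simp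
    moreover have "X \<in> tangent_space A x" "Y \<in> tangent_space A x"
      using XY(1,3) sub_tangent_subset[OF atlas] by blast+
    ultimately show ?thesis using metric_in_component[OF d, of X Y g] XY(2,4) by simp
  qed
  have H: "subspace ?H" by (rule linear_subspace_kernel[OF l])
  have "dim ?H \<ge> DIM('e) - 1"
  proof -
    \<comment> \<open>The Euclidean gradient of \<open>l\<close>: the kernel is its orthogonal
      hyperplane, or the whole space if \<open>a = 0\<close>.\<close>
    define a where "a = (\<Sum>b\<in>Basis. l b *\<^sub>R b)"
    have "l u = a \<bullet> u" for u
      using linear_eq_sum_Basis[OF l, of u]
      by (simp add: a_def inner_sum_left inner_commute[of u] mult.commute)
    then show ?thesis
      by (cases "a = 0") (simp_all add: dim_hyperplane)
  qed
  moreover have "dim {y + z |y z. y \<in> Q \<and> z \<in> ?H} \<le> DIM('e)" by (rule dim_subset_UNIV)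
  moreover have "DIM('e) \<ge> 1" by (simp add: Suc_leI)
  \<comment> \<open>The dimension of the model space cancels and \<open>n\<close> remains; its
    positivity keeps the truncated subtraction honest.\<close>
  ultimately have "2 \<le> dim (Q \<inter> ?H)"
    using dim_sums_Int[OF Q(1) H] Q(2) n by linarith
  then obtain B where B: "B \<subseteq> Q \<inter> ?H" "independent B" "card B \<ge> 2"
    using basis_exists[of "Q \<inter> ?H"] by metis
  then obtain u v where uv: "u \<in> B" "v \<in> B" "u \<noteq> v"
    using card_le_Suc0_iff_eq[of B] independent_imp_finite[of B] by force
  have "independent {u, v}" by (rule independent_mono[OF B(2)]) (use uv in simp)
  have "\<exists>a b. (a, b) \<noteq> (0, 0) \<and> a *\<^sub>R u + b *\<^sub>R v = 0"
    by (rule lorentz_form_isotropic_pair[OF lorentzian_metric_form[OF lorentzian d]])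
      (use iso uv B(1) in auto)
  then obtain a b where ab: "(a, b) \<noteq> (0, 0)" "a *\<^sub>R u + b *\<^sub>R v = 0" by blast
  have "(\<Sum>y\<in>{u, v}. (if y = u then a else b) *\<^sub>R y) = 0" using ab(2) uv(3) by simp
  then have "\<forall>y\<in>{u, v}. (if y = u then a else b) = 0"
    by (intro ballI independentD[OF \<open>independent {u, v}\<close> _ subset_refl]) simp_all
  then show False using ab(1) uv(3) by auto
qed

text \<open>The chain rule gives the velocity of the reparametrized ray as the derivative of
  \<open>h\<close> times \<open>U\<close>, the integral curve equation as \<open>f\<close> times
  \<open>U\<close>; a nonzero component of \<open>U\<close> can be cancelled.\<close>

lemma ray_real_derivative:
  assumes "p \<in> S" and J: "open J" "s \<in> J" "\<And>s. s \<in> J \<Longrightarrow> (p, h s) \<in> D"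
    and h: "smooth_on J h"
    and curve: "integral_curve A (\<lambda>x. tscale (f x) (U x)) J (\<lambda>s. \<Phi> (p, h s))"
  shows "(h has_real_derivative f (\<Phi> (p, h s))) (at s)"
proof -
  let ?x = "\<Phi> (p, h s)"
  have smooth: "smooth_map flat_atlas A J (\<lambda>s. \<Phi> (p, h s))"
    using curve by (simp add: integral_curve_def real_atlas_eq)
  obtain d where d: "d \<in> A" "?x \<in> cdom d" by (rule smooth_structure_chart[OF struct])
  obtain h' where h': "(h has_real_derivative h') (at s)"
    using smooth_onD(1)[OF h J(2)] differentiableI real_differentiable_def by blast
  have "((\<lambda>s. coord d (\<Phi> (p, h s))) has_vector_derivative h' *\<^sub>R U ?x d) (at s)"
    using vector_diff_chain_at[OF h'[unfolded has_real_derivative_iff_has_vector_derivative]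
      ray_derivative[OF J(3)[OF J(2)] d]] by (simp add: o_def)
  moreover have "((\<lambda>s. coord d (\<Phi> (p, h s))) has_vector_derivative f ?x *\<^sub>R U ?x d) (at s)"
    using curve_derivative[OF atlas smooth J(1,2) d] curve J(2) by (simp add: integral_curve_def)
  ultimately have "h' *\<^sub>R U ?x d = f ?x *\<^sub>R U ?x d" by (rule vector_derivative_unique_at)
  then have "h' = f ?x" using U_component_nonzero[OF J(3)[OF J(2)] d] by simp
  then show ?thesis using h' by simp
qed

lemma smooth_fun_ray_continuous:
  assumes f: "smooth_fun A \<Sigma> f" and p: "p \<in> S"
  shows "continuous_on (ray_dom p) (\<lambda>r. f (\<Phi> (p, r)))"
proof -
  have "(\<lambda>r. \<Phi> (p, r)) ` ray_dom p \<subseteq> \<Sigma>" by (auto simp: ray_dom_def)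
  from smooth_map_compose[OF smooth_atlas_flat atlas smooth_atlas_flat ray_smooth
      f[unfolded smooth_fun_def real_atlas_eq] this]
  have sm: "smooth_map flat_atlas flat_atlas (ray_dom p) (\<lambda>r. f (\<Phi> (p, r)))" .
  show ?thesis
  proof (rule continuous_at_imp_continuous_on, rule ballI)
    fix r assume r: "r \<in> ray_dom p"
    have "flat_chart \<in> flat_atlas" "f (\<Phi> (p, r)) \<in> cdom flat_chart" by (simp_all add: flat_atlas_def)
    then obtain W where "open W" "r \<in> W" "smooth_on W (\<lambda>z. coord flat_chart (f (\<Phi> (p, z))))"
      by (rule smooth_map_flat_open[OF smooth_atlas_flat sm ray_dom_open[OF p] r])
    then show "isCont (\<lambda>r. f (\<Phi> (p, r))) r"
      using smooth_onD(3) continuous_on_eq_continuous_at by fastforce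
  qed
qed

end

section \<open>Oriented substitution and comparison of the conformal factors\<close>

lemma interval_integral_substitution_oriented:
  fixes h h' :: "real \<Rightarrow> real" and F :: "real \<Rightarrow> real"
  assumes "is_interval J" "0 \<in> J" "s \<in> J"
    and h: "\<And>r. r \<in> J \<Longrightarrow> (h has_real_derivative h' r) (at r)"
    and cont: "continuous_on (h ` J) F" "continuous_on J h'"
  shows "(LBINT r=ereal 0..ereal s. h' r * F (h r)) = (LBINT y=ereal (h 0)..ereal (h s). F y)"
proof -
  have sub: "(LBINT r=ereal a..ereal b. h' r * F (h r)) = (LBINT y=ereal (h a)..ereal (h b). F y)"
    if "a \<le> b" "a \<in> J" "b \<in> J" for a b
  proof -
    have ab: "{a..b} \<subseteq> J" using mem_is_interval_1_I[OF assms(1) that(2,3)] by auto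
    have "(h has_real_derivative h' x) (at x within {a..b})" if "a \<le> x" "x \<le> b" for x
    proof -
      have "x \<in> J" using ab that by auto
      then show ?thesis by (rule has_field_derivative_at_within[OF h])
    qed
    moreover have "continuous_on (h ` {a..b}) F" "continuous_on {a..b} h'"
      using cont ab by (auto intro: continuous_on_subset)
    ultimately show ?thesis
      using interval_integral_substitution_finite[OF that(1), of h h' F] by simp
  qed
  show ?thesis
  proof (cases "0 \<le> s")
    case True
    then show ?thesis using assms(2,3) by (intro sub)
  next
    case False
    \<comment> \<open>Substitution is applied on the interval from \<open>s\<close> to 0; reversing
      the endpoints then changes the sign on both sides.\<close>
    then have "(LBINT r=ereal s..ereal 0. h' r * F (h r)) = (LBINT y=ereal (h s)..ereal (h 0). F y)"
      using assms(2,3) by (intro sub) simp_all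
    then show ?thesis
      using interval_integral_endpoints_reverse[of "ereal 0" "ereal s" "\<lambda>r. h' r * F (h r)"]
        interval_integral_endpoints_reverse[of "ereal (h 0)" "ereal (h s)" F] by simp
  qed
qed

theorem proposition7p2:
  fixes A :: "('m::{t2_space, second_countable_topology}, 'e::euclidean_space) chart set"
    and g :: "('m, 'e) metric"
    and \<Gamma> :: "('m, 'e) conn"
    and n :: nat
    and S Sig :: "'m set"
    and \<xi> U Ubar :: "'m \<Rightarrow> ('m, 'e) tvec"
    and V :: "('m \<times> ('m, 'e) tvec) set"
    and D Dbar :: "('m \<times> real) set"
    and \<Phi> \<Phi>bar :: "'m \<times> real \<Rightarrow> 'm"
    and \<mu> \<mu>bar f :: "'m \<Rightarrow> real"
    and h :: "'m \<Rightarrow> real \<Rightarrow> real"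
    and J :: "'m \<Rightarrow> real set"
  assumes "DIM('e) = n + 2" and "n + 2 \<ge> 4"
    and "spacetime A g" and "levi_civita A g \<Gamma>"
    and "embedded_submanifold A n S" and "connected S" and "spacelike A g S"
    and "lightlike_normal_field A g S \<xi>"
    and "normal_exp_nbhd A g \<Gamma> S V"
    and D_eq: "D = null_domain S \<xi> V"
    and Phi_eq: "\<Phi> = null_param A \<Gamma> \<xi>"
    and Sig_eq: "Sig = \<Phi> ` D"
    and U_eq: "U = push_dt A D \<Phi>"
    and umbilical: "umbilical_factor A g \<Gamma> Sig U \<mu>"
    and "smooth_fun A Sig f" and "\<forall>x\<in>Sig. f x \<noteq> 0"
    and Ubar_eq: "Ubar = (\<lambda>x. tscale (f x) (U x))"
    and umbilical_bar: "umbilical_factor A g \<Gamma> Sig Ubar \<mu>bar"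
    and h: "\<forall>p\<in>S. open (J p) \<and> is_interval (J p) \<and> 0 \<in> J p \<and> smooth_on (J p) (h p) \<and>
              (strict_mono_on (J p) (h p) \<or> strict_antimono_on (J p) (h p)) \<and> h p 0 = 0 \<and>
              (\<forall>s\<in>J p. (p, h p s) \<in> D)"
    and Phibar_eq: "\<Phi>bar = (\<lambda>(p, s). \<Phi> (p, h p s))"
    and integral: "\<forall>p\<in>S. integral_curve A Ubar (J p) (\<lambda>s. \<Phi>bar (p, s))"
    and Dbar_eq: "Dbar = {(p, s). p \<in> S \<and> s \<in> J p}"
  shows "\<forall>(p, s)\<in>Dbar.
           conformal_factor Dbar \<Phi>bar \<mu>bar (\<Phi>bar (p, s)) = conformal_factor D \<Phi> \<mu> (\<Phi> (p, h p s))"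
proof -
  interpret null_exponential A g \<Gamma> S \<xi> V
    using assms(3,8,9) by unfold_locales (auto simp: spacetime_def)
  have conn: "affine_connection A \<Gamma>" using assms(4) by (simp add: levi_civita_def)
  note f = assms(15)[unfolded Sig_eq Phi_eq D_eq]
  have \<mu>: "umbilical_factor A g \<Gamma> (null_param A \<Gamma> \<xi> ` null_domain S \<xi> V)
      (push_dt A (null_domain S \<xi> V) (null_param A \<Gamma> \<xi>)) \<mu>"
    using umbilical unfolding Sig_eq U_eq Phi_eq D_eq .
  have \<mu>bar: "umbilical_factor A g \<Gamma> (null_param A \<Gamma> \<xi> ` null_domain S \<xi> V)
      (\<lambda>x. tscale (f x) (push_dt A (null_domain S \<xi> V) (null_param A \<Gamma> \<xi>) x)) \<mu>bar"
    using umbilical_bar unfolding Ubar_eq Sig_eq U_eq Phi_eq D_eq .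
  have inj: "inj_on \<Phi> D" using Phi_inj by (simp add: Phi_eq D_eq)
  \<comment> \<open>A negative \<open>f\<close> reverses the ray and makes \<open>h p\<close>
    decreasing, hence the two alternatives.\<close>
  have inj_h: "inj_on (h p) (J p)" if "p \<in> S" for p
  proof (rule inj_onI)
    fix a b assume "a \<in> J p" "b \<in> J p" and eq: "h p a = h p b"
    moreover have "strict_mono_on (J p) (h p) \<or> strict_antimono_on (J p) (h p)" using h that by blast
    ultimately show "a = b"
      by (cases a b rule: linorder_cases) (auto dest: monotone_onD)
  qed
  \<comment> \<open>\<open>conformal_factor\<close> recovers the parameters of a point by
    \<open>inv_into\<close>; injectivity ensures that these are the intended \<open>p\<close> and
    \<open>s\<close>.\<close>
  have inj_bar: "inj_on \<Phi>bar Dbar"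
  proof (rule inj_onI, clarify)
    fix p s q r assume ps: "(p, s) \<in> Dbar" and qr: "(q, r) \<in> Dbar" and eq: "\<Phi>bar (p, s) = \<Phi>bar (q, r)"
    then have "(p, h p s) \<in> D" "(q, h q r) \<in> D" using h by (auto simp: Dbar_eq)
    moreover have "\<Phi> (p, h p s) = \<Phi> (q, h q r)" using eq by (simp add: Phibar_eq)
    ultimately have "(p, h p s) = (q, h q r)" by (rule inj_onD[OF inj, rotated])
    then show "p = q \<and> s = r" using inj_h ps qr by (auto simp: Dbar_eq dest: inj_onD)
  qed
  show ?thesis
  proof clarify
    fix p s assume ps: "(p, s) \<in> Dbar"
    then have p: "p \<in> S" and s: "s \<in> J p" by (auto simp: Dbar_eq)
    have J: "open (J p)" "is_interval (J p)" "0 \<in> J p" "smooth_on (J p) (h p)" "h p 0 = 0"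
      and hD: "\<And>s. s \<in> J p \<Longrightarrow> (p, h p s) \<in> D" using h p by auto
    let ?F = "\<lambda>r. \<mu> (\<Phi> (p, r))" and ?h' = "\<lambda>r. f (\<Phi> (p, h p r))"
    have dh: "(h p has_real_derivative ?h' r) (at r)" if "r \<in> J p" for r
      unfolding Phi_eq
      by (rule ray_real_derivative[OF p J(1) that _ J(4)])
        (use hD integral p in \<open>auto simp: D_eq Phibar_eq Ubar_eq U_eq Phi_eq\<close>)
    have img: "h p ` J p \<subseteq> ray_dom p" using hD by (auto simp: ray_dom_def D_eq)
    have "smooth_fun A (null_param A \<Gamma> \<xi> ` null_domain S \<xi> V) \<mu>"
      using \<mu> by (simp add: umbilical_factor_def)
    from smooth_fun_ray_continuous[OF this p] smooth_fun_ray_continuous[OF f p]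
    have contF: "continuous_on (h p ` J p) ?F" and cf: "continuous_on (ray_dom p) (\<lambda>r. f (\<Phi> (p, r)))"
      using continuous_on_subset img by (auto simp: Phi_eq)
    have conth': "continuous_on (J p) ?h'"
      by (rule continuous_on_compose2[OF cf smooth_onD(3)[OF J(4)] img])
    have factor: "\<mu>bar (\<Phi>bar (p, r)) = ?h' r * ?F (h p r)" if "r \<in> J p" for r
      using umbilical_factor_tscale[OF assms(5) _ conn f \<mu> \<mu>bar] hD[OF that] assms(2)
      by (simp add: Phibar_eq Phi_eq D_eq)
    \<comment> \<open>The parameters between 0 and \<open>s\<close>, for either sign of
      \<open>s\<close>, are those at which the integrand is rewritten.\<close>
    have "{min 0 s..max 0 s} \<subseteq> J p"
      using mem_is_interval_1_I[OF J(2,3) s] mem_is_interval_1_I[OF J(2) s J(3)]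
      by (cases "0 \<le> s") auto
    then have "(LBINT r=ereal 0..ereal s. \<mu>bar (\<Phi>bar (p, r))) = (LBINT r=ereal 0..ereal s. ?h' r * ?F (h p r))"
      by (intro interval_integral_cong factor) (auto simp: einterval_def min_def max_def split: if_splits)
    also have "\<dots> = (LBINT y=ereal (h p 0)..ereal (h p s). ?F y)"
      by (rule interval_integral_substitution_oriented[OF J(2,3) s dh contF conth'])
    \<comment> \<open>The normalization \<open>h p 0 = 0\<close> makes both integrals start at the
      same point of \<open>S\<close>.\<close>
    finally have "(LBINT r=ereal 0..ereal s. \<mu>bar (\<Phi>bar (p, r))) = (LBINT r=ereal 0..ereal (h p s). ?F r)"
      using J(5) by simp
    then show "conformal_factor Dbar \<Phi>bar \<mu>bar (\<Phi>bar (p, s)) = conformal_factor D \<Phi> \<mu> (\<Phi> (p, h p s))"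
      using inv_into_f_f[OF inj_bar ps] inv_into_f_f[OF inj hD[OF s]]
      by (simp add: conformal_factor_def)
  qed
qed

end
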